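(* Let $G$ be a planar graph of girth at least $7$ and let $\pi:E(G)\to\mathbb{F}_2$. Then there exists a strict $3$-inversion of $(G,\pi)$.
   Context: Graphs are finite and simple; the girth of a graph is the length of a shortest cycle (infinite for forests). For a positive integer $t$, a $t$-inversion of $(G,\pi)$ is an assignment of a vector $\mathbf{u}\in\mathbb{F}_2^t$ to each vertex $u\in V(G)$ such that $\pi(uv)=\mathbf{u}\cdot\mathbf{v}$ (standard dot product over $\mathbb{F}_2$) for every edge $uv\in E(G)$. A $t$-inversion is strict if every vertex is assigned a non-null vector. *)

theory Defs
  imports "HOL-Analysis.Analysis" "HOL-Library.Z2" "HOL-Library.Extended_Nat"
begin

definition finite_simple_graph :: "'a set \<Rightarrow> 'a set set \<Rightarrow> bool" where
  "finite_simple_graph V E \<longleftrightarrow> finite V \<and> (\<forall>e\<in>E. e \<subseteq> V \<and> card e = 2)"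

text \<open>A cycle is given by the list of its vertices in cyclic order, without repeating the first
  vertex at the end, so that its length is the length of the list.\<close>

definition graph_cycle :: "'a set set \<Rightarrow> 'a list \<Rightarrow> bool" where
  "graph_cycle E c \<longleftrightarrow>
     3 \<le> length c \<and> distinct c \<and>
     (\<forall>i<length c. {c ! i, c ! ((i + 1) mod length c)} \<in> E)"

text \<open>For a forest the infimum is over the empty set, which gives \<open>\<infinity>\<close>.\<close>

definition girth :: "'a set set \<Rightarrow> enat" where
  "girth E = (INF c\<in>{c. graph_cycle E c}. enat (length c))"

text \<open>Drawings in the plane, which is represented by the type \<^typ>\<open>complex\<close> as in the library's
  Jordan curve theorem. The vertex \<open>v\<close> is drawn as the point \<open>p v\<close> and the edge \<open>e\<close> as the simple
  arc \<open>\<gamma> e\<close>, in either direction, joining the images of its two ends. The condition on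
  \<open>path_image (\<gamma> e) \<inter> p ` V\<close> keeps an edge away from all vertices except its ends; the last
  condition says that distinct edges meet at most in the images of their common ends.\<close>

definition plane_drawing ::
    "'a set \<Rightarrow> 'a set set \<Rightarrow> ('a \<Rightarrow> complex) \<Rightarrow> ('a set \<Rightarrow> real \<Rightarrow> complex) \<Rightarrow> bool" where
  "plane_drawing V E p \<gamma> \<longleftrightarrow>
     inj_on p V \<and>
     (\<forall>e\<in>E. arc (\<gamma> e) \<and> {pathstart (\<gamma> e), pathfinish (\<gamma> e)} = p ` e \<and>
            path_image (\<gamma> e) \<inter> p ` V = p ` e) \<and>
     (\<forall>e\<in>E. \<forall>f\<in>E. e \<noteq> f \<longrightarrow> path_image (\<gamma> e) \<inter> path_image (\<gamma> f) = p ` (e \<inter> f))"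

definition planar_graph :: "'a set \<Rightarrow> 'a set set \<Rightarrow> bool" where
  "planar_graph V E \<longleftrightarrow> (\<exists>p \<gamma>. plane_drawing V E p \<gamma>)"

text \<open>The dimension \<open>t\<close> is the cardinality of the index type \<open>'t\<close>. Edges are the two-element
  sets \<open>{u, v}\<close>; the values of the labelling \<open>\<pi>\<close> outside \<open>E\<close> and of \<open>x\<close> outside \<open>V\<close> are
  irrelevant.\<close>

definition inversion :: "'a set set \<Rightarrow> ('a set \<Rightarrow> bit) \<Rightarrow> ('a \<Rightarrow> bit ^ 't) \<Rightarrow> bool" where
  "inversion E \<pi> x \<longleftrightarrow>
     (\<forall>u v. {u, v} \<in> E \<longrightarrow> \<pi> {u, v} = scalar_product (x u) (x v))"

definition strict_inversion ::
    "'a set \<Rightarrow> 'a set set \<Rightarrow> ('a set \<Rightarrow> bit) \<Rightarrow> ('a \<Rightarrow> bit ^ 't) \<Rightarrow> bool" where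
  "strict_inversion V E \<pi> x \<longleftrightarrow> inversion E \<pi> x \<and> (\<forall>u\<in>V. x u \<noteq> 0)"

end

theory Submission
  imports Defs
begin

text \<open>A minimal counterexample is excluded by discharging. A set \<open>F\<close> of vertices hanging at a vertex
  \<open>w\<close> is deleted, the rest is inverted by minimality, and one counts the values at \<open>w\<close> for which \<open>F\<close>
  can no longer be completed. There are seven nonzero vectors, an equation
  \<open>a \<bullet> x = \<alpha>\<close> with \<open>x \<noteq> 0\<close> has at least three nonzero solutions \<open>a\<close>, and two such equations with
  distinct \<open>x\<close> have at most two. Hence a vertex that keeps three admissible vectors blocks at most one value of
  a neighbour, and a vertex that keeps two blocks at most two. This makes enough configurations
  reducible to force \<open>5|E| \<ge> 7|V|\<close>, independently of the labels.

  Conversely a plane graph of girth at least 7 satisfies \<open>5|E| \<le> 7|V| - 7\<close>. Instead of Euler's formula one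
  shows \<open>5|E| + |c| \<le> 7|V| - 7\<close> for a plane graph drawn in the closed inside of one of its cycles \<open>c\<close>:
  the bound is additive when an ear splits the inside into two, which is the theta-curve form of the Jordan curve
  theorem. A general plane graph is cut along any cycle, and its outer part is turned
  into an inner one by an inversion of the plane.\<close>

section \<open>Vectors over the field with two elements\<close>

text \<open>Reducibility is a balance at a single vertex: its deleted branches may block fewer
  values than the 7 available if every neighbour is deleted, or the 3 left by one undeleted
  neighbour. Two undeleted neighbours may leave a single nonzero value, so each deleted vertex keeps
  at most one besides the vertex it hangs from. Adding up blocked values requires the branches at a
  vertex to be disjoint and joined by no edge; girth 7 nearly guarantees this down to depth 3, and
  no deeper branch occurs. The density bound comes from the charges 10d - 28, whose sum is 20|E| -
  28|V|. The bound 5|E| + |c| + 7 <= 7|V| is what Euler's formula yields for a connected plane graph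
  when \<open>c\<close> bounds the outer face and every other face has length at least 7. For a
  graph as a whole the constant 7, weaker than Euler's 14, is used because it is also correct for a
  single vertex, hence for every piece that arises when the graph is cut.\<close>

lemma sum_vec3: "(\<Sum>w\<in>(UNIV :: (bit^3) set). f w) =
  (\<Sum>i\<in>UNIV. \<Sum>j\<in>UNIV. \<Sum>k\<in>UNIV. f (vector [i, j, k]))"
proof -
  have "bij_betw (\<lambda>(i, j, k). vector [i, j, k] :: bit^3) UNIV UNIV"
    by (rule bij_betw_byWitness[where f' = "\<lambda>v. (v$1, v$2, v$3)"])
      (auto simp: vec_eq_iff forall_3)
  from sum.reindex_bij_betw[OF this, of f, symmetric] show ?thesis
    by (simp add: UNIV_Times_UNIV[symmetric] sum.cartesian_product split_def del: UNIV_Times_UNIV)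
qed

lemma UNIV_bit: "(UNIV :: bit set) = {0, 1}"
proof (rule UNIV_eq_I)
  show "x \<in> {0, 1}" for x :: bit by (cases x) auto
qed

lemma vec3_cases: obtains i j k where "(a :: bit^3) = vector [i, j, k]"
proof
  show "a = vector [a$1, a$2, a$3]" by (simp add: vec_eq_iff forall_3)
qed

lemma finite_vec3 [simp]: "finite (S :: (bit^3) set)"
proof (rule finite_subset)
  show "S \<subseteq> (\<lambda>(i, j, k). vector [i, j, k]) ` ({0, 1} \<times> {0, 1} \<times> {0, 1})"
  proof
    fix v :: "bit^3"
    obtain i j k where "v = vector [i, j, k]" by (rule vec3_cases)
    then show "v \<in> (\<lambda>(i, j, k). vector [i, j, k]) ` ({0, 1} \<times> {0, 1} \<times> {0, 1})"
      unfolding UNIV_bit[symmetric] by (intro image_eqI[of _ _ "(i, j, k)"]) simp_all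
  qed
qed simp

text \<open>Turns counting into a sum of eight explicit terms, so that the counts below are decided
  by evaluation.\<close>

lemma card_vec3: "card {w :: bit^3. P w} = (\<Sum>i\<in>{0,1}. \<Sum>j\<in>{0,1}. \<Sum>k\<in>{0,1}. if P (vector [i, j, k]) then 1 else 0)"
proof -
  have "card {w :: bit^3. P w} = (\<Sum>w\<in>UNIV. if P w then 1 else 0)"
    using sum.inter_filter[of UNIV "\<lambda>_. 1 :: nat" P] by simp
  then show ?thesis by (simp only: sum_vec3 UNIV_bit)
qed

lemma vector3_eq: "(vector [i,j,k] :: bit^3) = vector [i',j',k'] \<longleftrightarrow> i = i' \<and> j = j' \<and> k = k'"
  by (simp add: vec_eq_iff forall_3)

lemma vector3_eq_0: "(vector [i,j,k] :: bit^3) = 0 \<longleftrightarrow> i = 0 \<and> j = 0 \<and> k = 0"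
  by (simp add: vec_eq_iff forall_3)

lemma scalar_product_vector3: "scalar_product (vector [i,j,k] :: bit^3) (vector [i',j',k']) = i*i' + j*j' + k*k'"
  by (simp add: scalar_product_def sum_3)

lemma card_nonzero: "card {w :: bit^3. w \<noteq> 0} = 7"
  by (simp add: card_vec3 vector3_eq_0)

text \<open>The solutions form an affine plane of four points, which contains \<open>0\<close>
  exactly for \<open>\<alpha> = 0\<close>; excluding \<open>0\<close> costs at most one.\<close>

lemma card_hyperplane: "(a :: bit^3) \<noteq> 0 \<Longrightarrow> 3 \<le> card {w. w \<noteq> 0 \<and> scalar_product w a = \<alpha>}"
  by (rule vec3_cases[of a], rename_tac i j k, case_tac i; case_tac j; case_tac k; cases \<alpha>)
    (simp_all add: card_vec3 vector3_eq_0 scalar_product_vector3)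

text \<open>Distinct nonzero vectors over the field with two elements are linearly independent, so
  the two equations cut out an affine line, which has two points.\<close>

lemma card_two_planes:
  "(a :: bit^3) \<noteq> 0 \<Longrightarrow> b \<noteq> 0 \<Longrightarrow> a \<noteq> b \<Longrightarrow>
    card {w. scalar_product w a = \<alpha> \<and> scalar_product w b = \<beta>} \<le> 2"
  by (rule vec3_cases[of a], rule vec3_cases[of b], rename_tac i j k i' j' k',
      case_tac i; case_tac j; case_tac k; case_tac i'; case_tac j'; case_tac k'; cases \<alpha>; cases \<beta>)
    (simp_all add: card_vec3 vector3_eq vector3_eq_0 scalar_product_vector3)

lemma scalar_product_commute: "scalar_product x y = scalar_product y (x :: bit^3)"
  unfolding scalar_product_def by (intro sum.cong refl mult.commute)

lemma exists_not_in: "card Z < card A \<Longrightarrow> finite Z \<Longrightarrow> \<exists>a\<in>A. a \<notin> Z"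
  by (meson card_mono leD subsetI)

text \<open>Over two elements, missing the value \<open>p\<close> means taking \<open>p + 1\<close>.
  A blocked \<open>c\<close> therefore solves two equations, given by two members of
  \<open>A\<close>.\<close>

lemma card_blocked_le_2:
  fixes A :: "(bit^3) set"
  assumes "\<And>a. a \<in> A \<Longrightarrow> a \<noteq> 0" "2 \<le> card A"
  shows "card {c. c \<noteq> 0 \<and> (\<forall>a\<in>A. scalar_product c a \<noteq> p)} \<le> 2"
proof -
  obtain a b where ab: "a \<in> A" "b \<in> A" "a \<noteq> b"
    using assms(2) card_le_Suc0_iff_eq[of A] by fastforce
  have "{c. c \<noteq> 0 \<and> (\<forall>a\<in>A. scalar_product c a \<noteq> p)} \<subseteq>
      {c. scalar_product c a = p + 1 \<and> scalar_product c b = p + 1}"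
    using ab by (cases p) auto
  from card_mono[OF finite_vec3 this] card_two_planes[OF assms(1)[OF ab(1)] assms(1)[OF ab(2)] ab(3)]
  show ?thesis by (rule order_trans)
qed

text \<open>The roles are exchanged: two blocked values would be the coefficients of two equations
  satisfied by all of \<open>A\<close>, which have at most two common solutions.\<close>

lemma card_blocked_le_1:
  fixes A :: "(bit^3) set"
  assumes "\<And>a. a \<in> A \<Longrightarrow> a \<noteq> 0" "3 \<le> card A"
  shows "card {c. c \<noteq> 0 \<and> (\<forall>a\<in>A. scalar_product c a \<noteq> p)} \<le> 1" (is "card ?Z \<le> 1")
proof (rule ccontr)
  assume "\<not> ?thesis"
  then obtain c d where cd: "c \<in> ?Z" "d \<in> ?Z" "c \<noteq> d"
    using card_le_Suc0_iff_eq[of ?Z] by (simp only: One_nat_def finite_vec3) blast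
  then have "A \<subseteq> {a. scalar_product a c = p + 1 \<and> scalar_product a d = p + 1}"
    by (cases p) (auto simp: scalar_product_commute)
  from card_mono[OF finite_vec3 this] card_two_planes[of c d "p + 1" "p + 1"] cd assms(2)
  show False by auto
qed

section \<open>Paths and cycles as vertex lists\<close>

fun pedges :: "'a list \<Rightarrow> 'a set set" where
  "pedges (x # y # zs) = insert {x, y} (pedges (y # zs))"
| "pedges _ = {}"

definition cedges :: "'a list \<Rightarrow> 'a set set" where
  "cedges c = pedges (c @ [hd c])"

lemma pedges_append: "pedges (xs @ x # ys) = pedges (xs @ [x]) \<union> pedges (x # ys)"
  by (induction xs rule: pedges.induct) auto

lemma pedges_rev [simp]: "pedges (rev xs) = pedges xs"
proof (induction xs rule: pedges.induct)
  case (1 x y zs)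
  have "pedges (rev (x # y # zs)) = pedges (rev (y # zs)) \<union> {{y, x}}"
    using pedges_append[of "rev zs" y "[x]"] by simp
  with 1 show ?case by (auto simp: insert_commute)
qed auto

lemma pedges_nth: "Suc i < length xs \<Longrightarrow> {xs ! i, xs ! Suc i} \<in> pedges xs"
proof (induction xs arbitrary: i rule: pedges.induct)
  case (1 x y zs)
  then show ?case by (cases i) auto
qed auto

lemma graph_cycleI:
  assumes "distinct c" "3 \<le> length c" "cedges c \<subseteq> E"
  shows "graph_cycle E c"
  unfolding graph_cycle_def
proof (intro conjI allI impI assms)
  fix i assume i: "i < length c"
  have "{(c @ [hd c]) ! i, (c @ [hd c]) ! Suc i} \<in> pedges (c @ [hd c])"
    using i by (intro pedges_nth) simp
  moreover have "(c @ [hd c]) ! Suc i = c ! ((i + 1) mod length c)"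
  proof (cases "Suc i = length c")
    case True
    with i have "c \<noteq> []" by auto
    with True show ?thesis by (simp add: nth_append hd_conv_nth)
  qed (use i in \<open>simp add: nth_append\<close>)
  moreover have "(c @ [hd c]) ! i = c ! i" using i by (simp add: nth_append)
  ultimately show "{c ! i, c ! ((i + 1) mod length c)} \<in> E"
    using assms(3) by (auto simp: cedges_def)
qed

lemma Union_pedges: "2 \<le> length xs \<Longrightarrow> \<Union> (pedges xs) = set xs"
proof (induction xs rule: pedges.induct)
  case (1 x y zs)
  then show ?case by (cases zs) auto
qed auto

lemma finite_pedges [simp]: "finite (pedges xs)"
  by (induction xs rule: pedges.induct) auto

lemma pedges_subset: "e \<in> pedges xs \<Longrightarrow> e \<subseteq> set xs"
  by (induction xs rule: pedges.induct) auto

lemma card_pedges_elem: "e \<in> pedges xs \<Longrightarrow> distinct xs \<Longrightarrow> card e = 2"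
  by (induction xs rule: pedges.induct) auto

lemma card_pedges: "distinct xs \<Longrightarrow> card (pedges xs) = length xs - 1"
proof (induction xs rule: pedges.induct)
  case (1 x y zs)
  have "{x, y} \<notin> pedges (y # zs)" using 1 pedges_subset[of "{x, y}" "y # zs"] by auto
  then show ?case using 1 by simp
qed auto

text \<open>An end of a path lies on only one of its edges. This rules out that a longer path uses
  the chord between its ends.\<close>

lemma pedges_ends:
  assumes "distinct xs" "{hd xs, last xs} \<in> pedges xs" shows "length xs = 2"
proof (cases xs rule: pedges.cases)
  case (1 x y zs)
  have "{x, last xs} \<notin> pedges (y # zs)"
    using assms(1) 1 pedges_subset[of "{x, last xs}" "y # zs"] by auto
  then have "last xs = y" using assms 1 by (auto simp: doubleton_eq_iff)
  then show ?thesis using 1 assms(1) last_in_set[of zs] by (cases zs) (auto split: if_splits)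
qed (use assms in auto)

text \<open>\<open>u\<close> and \<open>v\<close> cut the cycle into two arcs; the second is
  reversed so that both run from \<open>u\<close> to \<open>v\<close>.\<close>

lemma cedges_split:
  "cedges (u # as @ v # bs) = pedges (u # as @ [v]) \<union> pedges (u # rev bs @ [v])"
proof -
  have "pedges (v # bs @ [u]) = pedges (rev (v # bs @ [u]))" by (rule pedges_rev[symmetric])
  then show ?thesis using pedges_append[of "u # as" v "bs @ [u]"] by (simp add: cedges_def)
qed

text \<open>A common edge lies within \<open>{u, v}\<close>, hence equals it, and by
  \<open>pedges_ends\<close> both paths would be that single edge.\<close>

lemma paths_edge_disjoint:
  assumes "distinct xs" "distinct ys" "hd xs = u" "last xs = v" "u \<noteq> v"
    and "set xs \<inter> set ys = {u, v}" "hd ys = u" "last ys = v"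
    and "length xs > 2 \<or> length ys > 2"
  shows "pedges xs \<inter> pedges ys = {}"
proof -
  have "e \<notin> pedges ys" if e: "e \<in> pedges xs" for e
  proof
    assume e': "e \<in> pedges ys"
    have "e \<subseteq> {u, v}" using pedges_subset[OF e] pedges_subset[OF e'] assms(6) by auto
    then have "e = {u, v}" using card_pedges_elem[OF e assms(1)] assms(5) card_subset_eq[of "{u, v}" e] by simp
    then show False using pedges_ends[of xs] pedges_ends[of ys] e e' assms by auto
  qed
  then show ?thesis by auto
qed

lemma cycle_rotate:
  assumes "distinct c" "u \<in> set c" "v \<in> set c" "u \<noteq> v"
  obtains as bs where "distinct (u # as @ v # bs)" "cedges (u # as @ v # bs) = cedges c"
    "set (u # as @ v # bs) = set c" "length (u # as @ v # bs) = length c"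
proof -
  obtain xs ys where c: "c = xs @ u # ys" using split_list[OF assms(2)] by blast
  define d where "d = ys @ xs"
  have "v \<in> set d" using assms c by (auto simp: d_def)
  then obtain as bs where d: "d = as @ v # bs" using split_list[of v d] by blast
  have "cedges (u # d) = cedges c"
  proof (cases xs)
    case Nil
    then show ?thesis by (simp add: d_def c)
  next
    case (Cons x xs')
    have "cedges (u # d) = pedges ((u # ys) @ x # xs' @ [u])" by (simp add: cedges_def d_def Cons)
    also have "\<dots> = pedges (u # ys @ [x]) \<union> pedges (x # xs' @ [u])" by (subst pedges_append) simp
    also have "\<dots> = pedges ((x # xs') @ u # ys @ [x])" by (subst pedges_append) auto
    finally show ?thesis by (simp add: cedges_def c Cons)
  qed
  moreover have "distinct (u # d)" "set (u # d) = set c" "length (u # d) = length c"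
    using assms(1) by (auto simp: c d_def)
  ultimately show thesis using that[of as bs] by (simp only: d)
qed

lemma cedges_parts:
  assumes "distinct (u # as @ v # bs)" "3 \<le> length (u # as @ v # bs)"
  shows "pedges (u # as @ [v]) \<inter> pedges (u # rev bs @ [v]) = {}"
proof (rule paths_edge_disjoint)
  show "2 < length (u # as @ [v]) \<or> 2 < length (u # rev bs @ [v])" using assms by (cases as) auto
qed (use assms in auto)

text \<open>Cutting at two consecutive vertices leaves one edge and a path through all
  vertices.\<close>

lemma card_cedges:
  assumes "distinct c" "3 \<le> length c" shows "card (cedges c) = length c"
proof -
  obtain u v bs where c: "c = u # [] @ v # bs" using assms(2) by (cases c; cases "tl c") auto
  show ?thesis using cedges_parts[OF assms[unfolded c]] assms card_pedges[of "u # rev bs @ [v]"]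
    unfolding c cedges_split by (subst card_Un_disjoint) auto
qed

lemma Union_cedges: "2 \<le> length c \<Longrightarrow> \<Union> (cedges c) = set c"
  using Union_pedges[of "c @ [hd c]"] by (cases c) (auto simp: cedges_def)

text \<open>If the next vertex is already on the path, the path is cut back to it instead of being
  extended.\<close>

lemma rtrancl_path:
  assumes "(x, y) \<in> {(x, y). {x, y} \<in> F}\<^sup>*"
  shows "\<exists>xs. xs \<noteq> [] \<and> distinct xs \<and> hd xs = x \<and> last xs = y \<and> pedges xs \<subseteq> F"
  using assms
proof (induction rule: rtrancl_induct)
  case base
  show ?case by (intro exI[of _ "[x]"]) simp
next
  case (step y z)
  then obtain xs where xs: "xs \<noteq> []" "distinct xs" "hd xs = x" "last xs = y" "pedges xs \<subseteq> F" by auto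
  show ?case
  proof (cases "z \<in> set xs")
    case True
    then obtain as bs where s: "xs = as @ z # bs" by (meson split_list)
    then have "pedges (as @ [z]) \<subseteq> F" using xs(5) pedges_append[of as z bs] by auto
    then show ?thesis using xs s by (intro exI[of _ "as @ [z]"]) (auto simp: hd_append)
  next
    case False
    obtain ys where ys: "xs = ys @ [y]" using xs by (metis append_butlast_last_id)
    have "pedges (xs @ [z]) = pedges xs \<union> {{y, z}}" using pedges_append[of ys y "[z]"] by (simp add: ys)
    then show ?thesis using xs False step(2) by (intro exI[of _ "xs @ [z]"]) auto
  qed
qed

section \<open>Walks in graphs of girth at least seven\<close>

text \<open>A local condition, stable under gluing and reversal, that replaces distinctness for
  short walks by \<open>walk_distinct\<close>.\<close>

fun nonbacktracking :: "'a list \<Rightarrow> bool" where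
  "nonbacktracking (x # y # z # zs) \<longleftrightarrow> x \<noteq> z \<and> nonbacktracking (y # z # zs)"
| "nonbacktracking _ \<longleftrightarrow> True"

lemma nonbacktracking_glue:
  "nonbacktracking (as @ [y, w]) \<Longrightarrow> nonbacktracking (w # z # bs) \<Longrightarrow> y \<noteq> z \<Longrightarrow>
    nonbacktracking (as @ y # w # z # bs)"
proof (induction as)
  case (Cons a as)
  have "nonbacktracking (as @ [y, w])"
    using Cons.prems(1) by (cases as; cases "tl as") auto
  then have "nonbacktracking (as @ y # w # z # bs)" by (rule Cons.IH[OF _ Cons.prems(2,3)])
  with Cons.prems(1) show ?case by (cases as; cases "tl as") auto
qed auto

lemma nonbacktracking_rev [simp]: "nonbacktracking (rev xs) \<longleftrightarrow> nonbacktracking xs"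
proof -
  have *: "nonbacktracking (rev xs)" if "nonbacktracking xs" for xs :: "'a list"
    using that
  proof (induction xs rule: nonbacktracking.induct)
    case (1 x y z zs)
    then show ?case using nonbacktracking_glue[of "rev zs" z y x "[]"] by auto
  qed auto
  from *[of xs] *[of "rev xs"] show ?thesis by auto
qed

lemma nonbacktracking_Cons:
  "nonbacktracking (x # xs) \<longleftrightarrow> nonbacktracking xs \<and> (\<forall>y z zs. xs = y # z # zs \<longrightarrow> x \<noteq> z)"
  by (cases xs; cases "tl xs") auto

lemma pedges_Cons: "pedges (x # xs) = pedges xs \<union> (if xs = [] then {} else {{x, hd xs}})"
  by (cases xs) auto

locale girth7_graph =
  fixes V :: "'a set" and E :: "'a set set"
  assumes graph: "finite_simple_graph V E"
    and girth7: "distinct c \<Longrightarrow> 3 \<le> length c \<Longrightarrow> cedges c \<subseteq> E \<Longrightarrow> 7 \<le> length c"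
begin

lemma finite_V: "finite V"
  using graph by (simp add: finite_simple_graph_def)

lemma edgeD: assumes "{u, v} \<in> E" shows "u \<in> V" "v \<in> V" "u \<noteq> v"
proof -
  have "{u, v} \<subseteq> V" "card {u, v} = 2"
    using assms graph unfolding finite_simple_graph_def by blast+
  then show "u \<in> V" "v \<in> V" "u \<noteq> v" by auto
qed

text \<open>The first return to \<open>x\<close> closes a segment \<open>x # as\<close> of at most 6
  vertices: a loop if \<open>as\<close> is empty, a backtracking step if it is a singleton, and
  otherwise a cycle that is too short.\<close>

lemma walk_distinct:
  "pedges xs \<subseteq> E \<Longrightarrow> nonbacktracking xs \<Longrightarrow> length xs \<le> 7 \<Longrightarrow> distinct xs"
proof (induction xs)
  case (Cons x xs)
  have d: "distinct xs"
    using Cons by (auto simp: nonbacktracking_Cons pedges_Cons)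
  moreover have "x \<notin> set xs"
  proof
    assume "x \<in> set xs"
    then obtain as bs where xs: "xs = as @ x # bs" "x \<notin> set as" by (meson split_list_first)
    have *: "pedges (x # as @ [x]) \<subseteq> E"
      using Cons.prems(1) pedges_append[of "x # as" x bs] by (simp add: xs)
    consider "as = []" | y where "as = [y]" | "2 \<le> length as"
      by (cases as; cases "tl as") auto
    then show False
    proof cases
      case 1 then show False using * edgeD(3)[of x x] by auto
    next
      case 2 then show False using Cons.prems(2) by (simp add: xs)
    next
      case 3
      have "7 \<le> length (x # as)"
        using 3 d xs * by (intro girth7) (auto simp: cedges_def)
      with Cons.prems(3) show False by (simp add: xs)
    qed
  qed
  ultimately show ?case by simp
qed simp

definition N :: "'a \<Rightarrow> 'a set" where "N v = {u. {v, u} \<in> E}"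

lemma N_sym: "u \<in> N v \<longleftrightarrow> v \<in> N u"
  by (simp add: N_def insert_commute)

lemma N_subset: "N v \<subseteq> V"
  using edgeD by (auto simp: N_def)

lemma finite_N [simp]: "finite (N v)"
  using finite_subset[OF N_subset finite_V] .

lemma N_irrefl [simp]: "v \<notin> N v"
  using edgeD(3)[of v v] by (auto simp: N_def)

definition walk :: "'a \<Rightarrow> 'a \<Rightarrow> 'a list \<Rightarrow> 'a \<Rightarrow> bool" where
  "walk w y ws v \<longleftrightarrow>
    pedges (w # y # ws) \<subseteq> E \<and> nonbacktracking (w # y # ws) \<and> last (y # ws) = v"

text \<open>All walks from \<open>w\<close> to \<open>F\<close> start with \<open>y\<close> and have at most \<open>n\<close> edges; as \<open>ws\<close> lists the
  vertices after \<open>w, y\<close>, a walk has \<open>Suc (length ws)\<close> edges.\<close>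

definition branch :: "nat \<Rightarrow> 'a \<Rightarrow> 'a \<Rightarrow> 'a set \<Rightarrow> bool" where
  "branch n w y F \<longleftrightarrow> (\<forall>v\<in>F. \<exists>ws. walk w y ws v \<and> length ws < n \<and>
      (Suc (length ws) = n \<longrightarrow> card (N v) = 2))"

lemma branchE:
  assumes "branch n w y F" "v \<in> F"
  obtains ws where "walk w y ws v" "length ws < n" "Suc (length ws) = n \<longrightarrow> card (N v) = 2"
  using assms unfolding branch_def by auto

lemma branch_mono:
  assumes "branch n w y F" "n \<le> m"
  shows "branch m w y F"
  unfolding branch_def
proof
  fix v assume "v \<in> F"
  with assms(1) obtain ws where "walk w y ws v" "length ws < n"
      "Suc (length ws) = n \<longrightarrow> card (N v) = 2" by (rule branchE)
  with assms(2) show "\<exists>ws. walk w y ws v \<and> length ws < m \<and> (Suc (length ws) = m \<longrightarrow> card (N v) = 2)"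
    by (intro exI[of _ ws]) auto
qed

text \<open>For \<open>n \<le> 6\<close> the list \<open>w # y # ws\<close> has at most 7 entries,
  so \<open>walk_distinct\<close> forbids its return to \<open>w\<close>.\<close>

lemma branch_not_center:
  assumes "branch n w y F" "n \<le> 6" shows "w \<notin> F"
proof
  assume "w \<in> F"
  with assms(1) obtain ws where "walk w y ws w" "length ws < n" by (rule branchE)
  then have ws: "pedges (w # y # ws) \<subseteq> E" "nonbacktracking (w # y # ws)"
      "last (y # ws) = w" "length ws < n" by (simp_all only: walk_def)
  from walk_distinct[OF ws(1,2)] ws(3,4) assms(2) have "w \<notin> set (y # ws)" by simp
  with ws(3) show False by (metis last_in_set list.distinct(1))
qed

text \<open>Reversing one walk and appending the other gives a nonbacktracking walk through
  \<open>w\<close> with at most 7 vertices. An edge from \<open>v\<close> to \<open>v'\<close> would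
  close it to a cycle, which is long enough only if both walks have three edges; then both ends have
  degree 2 by the definition of \<open>branch\<close>.\<close>

lemma branches_disjoint:
  assumes "branch 3 w y F" "branch 3 w y' F'" "y \<noteq> y'" "v \<in> F" "v' \<in> F'"
  shows "v \<noteq> v'" and "{v, v'} \<in> E \<Longrightarrow> card (N v) = 2 \<and> card (N v') = 2"
proof -
  obtain ws where "walk w y ws v"
    and ws_len: "length ws < 3" "Suc (length ws) = 3 \<longrightarrow> card (N v) = 2"
    using branchE[OF assms(1,4)] by metis
  then have ws: "pedges (w # y # ws) \<subseteq> E" "nonbacktracking (w # y # ws)" "last (y # ws) = v"
    by (simp_all only: walk_def)
  obtain ws' where "walk w y' ws' v'"
    and ws'_len: "length ws' < 3" "Suc (length ws') = 3 \<longrightarrow> card (N v') = 2"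
    using branchE[OF assms(2,5)] by metis
  then have ws': "pedges (w # y' # ws') \<subseteq> E" "nonbacktracking (w # y' # ws')" "last (y' # ws') = v'"
    by (simp_all only: walk_def)
  define zs where "zs = rev (y # ws) @ w # y' # ws'"
  have "nonbacktracking (rev (w # y # ws))" using ws(2) by (simp only: nonbacktracking_rev)
  then have nb: "nonbacktracking zs"
    using nonbacktracking_glue[OF _ ws'(2) assms(3), of "rev ws"] by (simp add: zs_def)
  have "pedges zs = pedges (rev (w # y # ws)) \<union> pedges (w # y' # ws')"
    unfolding zs_def by (subst pedges_append) simp
  then have pe: "pedges zs \<subseteq> E" using ws(1) ws'(1) by (simp only: pedges_rev) blast
  have len: "length zs = length ws + length ws' + 3" by (simp add: zs_def)
  have d: "distinct zs" using walk_distinct[OF pe nb] ws_len(1) ws'_len(1) len by simp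
  have hd: "hd zs = v" using ws(3) by (simp add: zs_def hd_append hd_rev split: if_splits)
  have last: "last zs = v'" using ws'(3) by (simp add: zs_def)
  obtain ts where z: "zs = v # ts" using hd len by (cases zs) auto
  have "ts \<noteq> []" using len z by auto
  then have v': "v' \<in> set ts" using last z by auto
  show "v \<noteq> v'" using d z v' by auto
  show "card (N v) = 2 \<and> card (N v') = 2" if e: "{v, v'} \<in> E"
  proof (rule ccontr)
    assume "\<not> ?thesis"
    with ws_len ws'_len have l: "length (v' # zs) \<le> 7" using len by auto
    have "pedges (v' # zs) \<subseteq> E" using pe e hd z by (auto simp: pedges_Cons insert_commute)
    moreover have "nonbacktracking (v' # zs)"
      unfolding nonbacktracking_Cons
    proof (intro conjI nb allI impI)
      fix a b cs assume zz: "zs = a # b # cs"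
      with len have "cs \<noteq> []" by auto
      with zz last have "v' \<in> set cs" by auto
      with d zz show "v' \<noteq> b" by auto
    qed
    ultimately have "distinct (v' # zs)" using l by (rule walk_distinct)
    with v' z show False by simp
  qed
qed

text \<open>\<open>c \<noteq> w\<close> prevents backtracking at \<open>b\<close>. For
  \<open>n = 0\<close> the vertex \<open>b\<close> itself has the maximal depth, hence the demand on
  its degree.\<close>

lemma branch_step:
  assumes "b \<in> N w" "\<And>c. c \<in> C \<Longrightarrow> c \<noteq> w \<and> branch n b c (F c)" "0 < n \<or> card (N b) = 2"
  shows "branch (Suc n) w b (insert b (\<Union>c\<in>C. F c))"
  unfolding branch_def
proof
  fix v assume "v \<in> insert b (\<Union>c\<in>C. F c)"
  then consider "v = b" | c where "c \<in> C" "v \<in> F c" by auto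
  then show "\<exists>ws. walk w b ws v \<and> length ws < Suc n \<and> (Suc (length ws) = Suc n \<longrightarrow> card (N v) = 2)"
  proof cases
    case 1
    then show ?thesis using assms(1,3) by (intro exI[of _ "[]"]) (auto simp: N_def walk_def)
  next
    case 2
    from assms(2)[OF 2(1)] have "branch n b c (F c)" "c \<noteq> w" by auto
    from branchE[OF this(1) 2(2)] obtain ws where "walk b c ws v" "length ws < n"
      "Suc (length ws) = n \<longrightarrow> card (N v) = 2" by metis
    moreover from this(1) have "walk w b (c # ws) v"
      using assms(1) \<open>c \<noteq> w\<close> by (simp add: walk_def N_def)
    ultimately show ?thesis by (intro exI[of _ "c # ws"]) simp
  qed
qed

text \<open>The walk \<open>w # b # c # ws\<close> has at most 6 vertices, so an edge from
  \<open>v\<close> back to \<open>w\<close> would give a nonbacktracking walk of at most 7 vertices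
  visiting \<open>v\<close> twice.\<close>

lemma branch_nonadjacent:
  assumes "branch n b c F" "n \<le> 4" "w \<in> N b" "w \<noteq> c" "v \<in> F"
  shows "v \<notin> N w" "v \<noteq> w"
proof -
  obtain ws where "walk b c ws v" "length ws < n"
    using branchE[OF assms(1,5)] by metis
  then have ws: "pedges (b # c # ws) \<subseteq> E" "nonbacktracking (b # c # ws)"
      "last (c # ws) = v" "length ws < n" by (simp_all only: walk_def)
  have wb: "pedges (w # b # c # ws) \<subseteq> E" "nonbacktracking (w # b # c # ws)"
    using ws assms by (auto simp: N_def insert_commute)
  have d: "distinct (w # b # c # ws)" by (rule walk_distinct[OF wb]) (use ws(4) assms(2) in simp)
  have v: "v \<in> set (c # ws)" using ws(3) by (metis last_in_set list.distinct(1))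
  show "v \<noteq> w" using v d by auto
  show "v \<notin> N w"
  proof
    assume "v \<in> N w"
    then have e: "{v, w} \<in> E" by (simp add: N_def insert_commute)
    have "v \<noteq> b" using v d by auto
    then have "distinct (v # w # b # c # ws)"
      using wb e ws(4) assms(2) by (intro walk_distinct) auto
    with v show False by auto
  qed
qed

end

section \<open>Reducible configurations\<close>

context girth7_graph
begin

definition inverts_at :: "('a set \<Rightarrow> bit) \<Rightarrow> ('a \<Rightarrow> bit^3) \<Rightarrow> 'a \<Rightarrow> bool" where
  "inverts_at \<pi> x u \<longleftrightarrow> (\<forall>v\<in>N u. \<pi> {u, v} = scalar_product (x u) (x v))"

lemma inverts_at_sym: "inverts_at \<pi> x v \<Longrightarrow> v \<in> N u \<Longrightarrow> \<pi> {u, v} = scalar_product (x u) (x v)"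
  unfolding inverts_at_def using N_sym by (metis insert_commute scalar_product_commute)

text \<open>The assignment \<open>x\<close> is total and nowhere zero, so that no domain has to be carried along; it need not
  be an inversion off \<open>S\<close>.\<close>

definition extendable :: "('a set \<Rightarrow> bit) \<Rightarrow> 'a set \<Rightarrow> bool" where
  "extendable \<pi> S \<longleftrightarrow> (\<forall>x. (\<forall>v. x v \<noteq> 0) \<longrightarrow>
     (\<exists>x'. (\<forall>v. x' v \<noteq> 0) \<and> (\<forall>v. v \<notin> S \<longrightarrow> x' v = x v) \<and> (\<forall>u\<in>S. inverts_at \<pi> x' u)))"

text \<open>At most \<open>k\<close> nonzero values at \<open>w\<close> prevent the recolouring of \<open>F\<close>.\<close>

definition blocks :: "('a set \<Rightarrow> bit) \<Rightarrow> 'a set \<Rightarrow> 'a \<Rightarrow> nat \<Rightarrow> bool" where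
  "blocks \<pi> F w k \<longleftrightarrow> (\<forall>x. (\<forall>v. x v \<noteq> 0) \<longrightarrow> (\<exists>Z. card Z \<le> k \<and> (\<forall>a. a \<noteq> 0 \<longrightarrow> a \<notin> Z \<longrightarrow>
     (\<exists>x'. (\<forall>v. x' v \<noteq> 0) \<and> (\<forall>v. v \<notin> F \<longrightarrow> x' v = (x(w := a)) v) \<and>
       (\<forall>u\<in>F. inverts_at \<pi> x' u)))))"

lemma blocksE:
  assumes "blocks \<pi> F w k" "\<forall>v. x v \<noteq> 0"
  obtains Z where "card Z \<le> k" "\<forall>a. a \<noteq> 0 \<longrightarrow> a \<notin> Z \<longrightarrow>
     (\<exists>x'. (\<forall>v. x' v \<noteq> 0) \<and> (\<forall>v. v \<notin> F \<longrightarrow> x' v = (x(w := a)) v) \<and> (\<forall>u\<in>F. inverts_at \<pi> x' u))"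
proof -
  have "\<exists>Z. card Z \<le> k \<and> (\<forall>a. a \<noteq> 0 \<longrightarrow> a \<notin> Z \<longrightarrow>
     (\<exists>x'. (\<forall>v. x' v \<noteq> 0) \<and> (\<forall>v. v \<notin> F \<longrightarrow> x' v = (x(w := a)) v) \<and> (\<forall>u\<in>F. inverts_at \<pi> x' u)))"
    using assms(1)[unfolded blocks_def, THEN spec, of x] assms(2) by simp
  with that show thesis by blast
qed

lemma blocks_empty: "blocks \<pi> {} w 0"
  unfolding blocks_def
proof (intro allI impI exI[of _ "{}"] conjI)
  fix x :: "'a \<Rightarrow> bit^3" and a :: "bit^3" assume "\<forall>v. x v \<noteq> 0" "a \<noteq> 0"
  then show "\<exists>x'. (\<forall>v. x' v \<noteq> 0) \<and> (\<forall>v. v \<notin> {} \<longrightarrow> x' v = (x(w := a)) v) \<and> (\<forall>u\<in>{}. inverts_at \<pi> x' u)"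
    by (intro exI[of _ "x(w := a)"]) simp
qed simp

text \<open>Outside the union of the two blocked sets both completions exist, and they can be pasted
  because no edge joins \<open>F\<close> to \<open>F'\<close>.\<close>

lemma blocks_Un:
  assumes p: "blocks \<pi> F w k" "blocks \<pi> F' w k'"
    and d: "F \<inter> F' = {}" and na: "\<And>v v'. v \<in> F \<Longrightarrow> v' \<in> F' \<Longrightarrow> v' \<notin> N v"
  shows "blocks \<pi> (F \<union> F') w (k + k')"
  unfolding blocks_def
proof (intro allI impI)
  fix x :: "'a \<Rightarrow> bit^3" assume x: "\<forall>v. x v \<noteq> 0"
  obtain Z where Z: "card Z \<le> k" "\<forall>a. a \<noteq> 0 \<longrightarrow> a \<notin> Z \<longrightarrow>
     (\<exists>x'. (\<forall>v. x' v \<noteq> 0) \<and> (\<forall>v. v \<notin> F \<longrightarrow> x' v = (x(w := a)) v) \<and> (\<forall>u\<in>F. inverts_at \<pi> x' u))"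
    by (rule blocksE[OF p(1) x])
  obtain Z' where Z': "card Z' \<le> k'" "\<forall>a. a \<noteq> 0 \<longrightarrow> a \<notin> Z' \<longrightarrow>
     (\<exists>x'. (\<forall>v. x' v \<noteq> 0) \<and> (\<forall>v. v \<notin> F' \<longrightarrow> x' v = (x(w := a)) v) \<and> (\<forall>u\<in>F'. inverts_at \<pi> x' u))"
    by (rule blocksE[OF p(2) x])
  show "\<exists>Z. card Z \<le> k + k' \<and> (\<forall>a. a \<noteq> 0 \<longrightarrow> a \<notin> Z \<longrightarrow>
     (\<exists>x'. (\<forall>v. x' v \<noteq> 0) \<and> (\<forall>v. v \<notin> F \<union> F' \<longrightarrow> x' v = (x(w := a)) v) \<and>
       (\<forall>u\<in>F \<union> F'. inverts_at \<pi> x' u)))"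
  proof (intro exI[of _ "Z \<union> Z'"] conjI allI impI)
    show "card (Z \<union> Z') \<le> k + k'" using card_Un_le[of Z Z'] Z(1) Z'(1) by simp
  next
    fix a assume a: "a \<noteq> 0" "a \<notin> Z \<union> Z'"
    obtain y where y: "\<And>v. y v \<noteq> 0" "\<And>v. v \<notin> F \<Longrightarrow> y v = (x(w := a)) v" "\<And>u. u \<in> F \<Longrightarrow> inverts_at \<pi> y u"
      using Z(2)[rule_format, of a] a by auto
    obtain y' where y': "\<And>v. y' v \<noteq> 0" "\<And>v. v \<notin> F' \<Longrightarrow> y' v = (x(w := a)) v" "\<And>u. u \<in> F' \<Longrightarrow> inverts_at \<pi> y' u"
      using Z'(2)[rule_format, of a] a by auto
    define z where "z v = (if v \<in> F then y v else if v \<in> F' then y' v else (x(w := a)) v)" for v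
    \<comment> \<open>No neighbour of \<open>F\<close> lies in \<open>F'\<close>, so
      \<open>z\<close> agrees with \<open>y\<close> on \<open>F\<close> and on all its neighbours;
      symmetrically for \<open>y'\<close>.\<close>
    have zF: "z v = y v" if "v \<notin> F'" for v using that y(2)[of v] by (simp add: z_def)
    have zF': "z v = y' v" if "v \<notin> F" for v using that y'(2)[of v] by (simp add: z_def)
    show "\<exists>x'. (\<forall>v. x' v \<noteq> 0) \<and> (\<forall>v. v \<notin> F \<union> F' \<longrightarrow> x' v = (x(w := a)) v) \<and>
       (\<forall>u\<in>F \<union> F'. inverts_at \<pi> x' u)"
    proof (intro exI[of _ z] conjI allI impI ballI)
      show "z v \<noteq> 0" for v using y(1) y'(1) x a(1) by (simp add: z_def)
      show "z v = (x(w := a)) v" if "v \<notin> F \<union> F'" for v using that by (simp add: z_def)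
      fix u assume u: "u \<in> F \<union> F'"
      show "inverts_at \<pi> z u"
      proof (cases "u \<in> F")
        case True
        then have "u \<notin> F'" using d by auto
        moreover have "v \<notin> F'" if "v \<in> N u" for v using na[OF True] that by auto
        ultimately show ?thesis using y(3)[OF True] by (simp add: inverts_at_def zF)
      next
        case False
        with u have u': "u \<in> F'" by simp
        moreover have "v \<notin> F" if "v \<in> N u" for v using na[OF _ u'] that N_sym by auto
        ultimately show ?thesis using y'(3)[OF u'] False by (simp add: inverts_at_def zF')
      qed
    qed
  qed
qed

lemma blocks_UN:
  assumes "finite C" "\<And>c. c \<in> C \<Longrightarrow> blocks \<pi> (F c) w (k c)"
    and "\<And>c c' v v'. c \<in> C \<Longrightarrow> c' \<in> C \<Longrightarrow> c \<noteq> c' \<Longrightarrow> v \<in> F c \<Longrightarrow> v' \<in> F c' \<Longrightarrow> v \<noteq> v' \<and> v' \<notin> N v"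
  shows "blocks \<pi> (\<Union>c\<in>C. F c) w (\<Sum>c\<in>C. k c)"
  using assms
proof (induction C)
  case empty
  show ?case using blocks_empty by simp
next
  case (insert c C)
  have IH: "blocks \<pi> (\<Union>c\<in>C. F c) w (\<Sum>c\<in>C. k c)"
    by (rule insert.IH) (use insert.prems in \<open>blast+\<close>)
  have pc: "blocks \<pi> (F c) w (k c)" using insert.prems(1) by simp
  have *: "v \<noteq> v' \<and> v' \<notin> N v" if "v \<in> F c" "v' \<in> F c'" "c' \<in> C" for v v' c'
    using insert.prems(2)[of c c' v v'] that insert.hyps by auto
  have "blocks \<pi> (F c \<union> (\<Union>c\<in>C. F c)) w (k c + (\<Sum>c\<in>C. k c))"
    using * by (intro blocks_Un pc IH) blast+
  then show ?case using insert.hyps by simp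
qed

text \<open>\<open>A\<close> holds values at \<open>b\<close> that suit the neighbours outside
  \<open>F\<close>. More of them than \<open>F\<close> can block leaves one that works on both
  sides.\<close>

lemma extendable_center:
  assumes p: "blocks \<pi> F b k" and b: "b \<notin> F"
    and A: "\<And>x :: 'a \<Rightarrow> bit^3. \<forall>v. x v \<noteq> 0 \<Longrightarrow> \<exists>A. k < card A \<and> (\<forall>a\<in>A. a \<noteq> 0 \<and> (\<forall>v\<in>N b - F. \<pi> {b, v} = scalar_product a (x v)))"
  shows "extendable \<pi> (insert b F)"
  unfolding extendable_def
proof (intro allI impI)
  fix x :: "'a \<Rightarrow> bit^3" assume x: "\<forall>v. x v \<noteq> 0"
  obtain Z where Z: "card Z \<le> k" "\<forall>a. a \<noteq> 0 \<longrightarrow> a \<notin> Z \<longrightarrow>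
     (\<exists>x'. (\<forall>v. x' v \<noteq> 0) \<and> (\<forall>v. v \<notin> F \<longrightarrow> x' v = (x(b := a)) v) \<and> (\<forall>u\<in>F. inverts_at \<pi> x' u))"
    by (rule blocksE[OF p x])
  obtain A where A: "k < card A" "\<And>a. a \<in> A \<Longrightarrow> a \<noteq> 0 \<and> (\<forall>v\<in>N b - F. \<pi> {b, v} = scalar_product a (x v))"
    using A[OF x] by blast
  obtain a where a: "a \<in> A" "a \<notin> Z" using exists_not_in[of Z A] Z(1) A(1) by auto
  have "a \<noteq> 0" using a A(2) by auto
  with Z(2) a(2) obtain y where "(\<forall>v. y v \<noteq> 0) \<and> (\<forall>v. v \<notin> F \<longrightarrow> y v = (x(b := a)) v) \<and> (\<forall>u\<in>F. inverts_at \<pi> y u)"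
    by blast
  then have y: "\<And>v. y v \<noteq> 0" "\<And>v. v \<notin> F \<Longrightarrow> y v = (x(b := a)) v" "\<And>u. u \<in> F \<Longrightarrow> inverts_at \<pi> y u"
    by (simp_all del: fun_upd_apply)
  have "inverts_at \<pi> y b"
    unfolding inverts_at_def
  proof
    fix v assume v: "v \<in> N b"
    show "\<pi> {b, v} = scalar_product (y b) (y v)"
    proof (cases "v \<in> F")
      case True
      then show ?thesis using y(3) v by (blast intro: inverts_at_sym)
    next
      case False
      then show ?thesis using A(2)[OF a(1)] v b y(2) N_irrefl[of b] by fastforce
    qed
  qed
  then show "\<exists>x'. (\<forall>v. x' v \<noteq> 0) \<and> (\<forall>v. v \<notin> insert b F \<longrightarrow> x' v = x v) \<and> (\<forall>u\<in>insert b F. inverts_at \<pi> x' u)"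
    using y by (intro exI[of _ y]) auto
qed

text \<open>Of the \<open>k + m\<close> values at \<open>b\<close> suiting all neighbours outside
  \<open>F\<close> except \<open>w\<close>, at least \<open>m\<close> survive the blocking by
  \<open>F\<close>. A value at \<open>w\<close> is bad only if it fails with all survivors, which
  the counting lemmas limit to \<open>j\<close> values.\<close>

lemma blocks_parent:
  assumes p: "blocks \<pi> F b k" and b: "b \<notin> F" and w: "w \<notin> F" "b \<in> N w" "\<And>v. v \<in> F \<Longrightarrow> v \<notin> N w"
    and A: "\<And>x :: 'a \<Rightarrow> bit^3. \<forall>v. x v \<noteq> 0 \<Longrightarrow> \<exists>A. k + m \<le> card A \<and>
        (\<forall>a\<in>A. a \<noteq> 0 \<and> (\<forall>v\<in>N b - F - {w}. \<pi> {b, v} = scalar_product a (x v)))"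
    and m: "j = 1 \<and> 3 \<le> m \<or> j = 2 \<and> 2 \<le> m"
  shows "blocks \<pi> (insert b F) w j"
  unfolding blocks_def
proof (intro allI impI)
  fix x :: "'a \<Rightarrow> bit^3" assume x: "\<forall>v. x v \<noteq> 0"
  obtain Z where Z: "card Z \<le> k" "\<forall>a. a \<noteq> 0 \<longrightarrow> a \<notin> Z \<longrightarrow>
     (\<exists>x'. (\<forall>v. x' v \<noteq> 0) \<and> (\<forall>v. v \<notin> F \<longrightarrow> x' v = (x(b := a)) v) \<and> (\<forall>u\<in>F. inverts_at \<pi> x' u))"
    by (rule blocksE[OF p x])
  obtain A where A: "k + m \<le> card A"
      "\<And>a. a \<in> A \<Longrightarrow> a \<noteq> 0 \<and> (\<forall>v\<in>N b - F - {w}. \<pi> {b, v} = scalar_product a (x v))"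
    using A[OF x] by blast
  have "card A - card Z \<le> card (A - Z)" by (rule diff_card_le_card_Diff) simp
  then have cA: "m \<le> card (A - Z)" using A(1) Z(1) by simp
  have A0: "a \<noteq> 0" if "a \<in> A - Z" for a using A(2) that by auto
  define Y where "Y = {c. c \<noteq> 0 \<and> (\<forall>a\<in>A - Z. scalar_product c a \<noteq> \<pi> {b, w})}"
  have "card Y \<le> j"
    using m card_blocked_le_1[OF A0, of "A - Z"] card_blocked_le_2[OF A0, of "A - Z"] cA
    unfolding Y_def by fastforce
  moreover have "\<exists>x'. (\<forall>v. x' v \<noteq> 0) \<and> (\<forall>v. v \<notin> insert b F \<longrightarrow> x' v = (x(w := c)) v) \<and>
       (\<forall>u\<in>insert b F. inverts_at \<pi> x' u)" if c: "c \<noteq> 0" "c \<notin> Y" for c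
  proof -
    obtain a where a: "a \<in> A" "a \<notin> Z" "scalar_product c a = \<pi> {b, w}" using c by (auto simp: Y_def)
    have "a \<noteq> 0" using a A(2) by auto
    with Z(2) a(2) obtain y where "(\<forall>v. y v \<noteq> 0) \<and> (\<forall>v. v \<notin> F \<longrightarrow> y v = (x(b := a)) v) \<and> (\<forall>u\<in>F. inverts_at \<pi> y u)"
      by blast
    then have y: "\<And>v. y v \<noteq> 0" "\<And>v. v \<notin> F \<Longrightarrow> y v = (x(b := a)) v" "\<And>u. u \<in> F \<Longrightarrow> inverts_at \<pi> y u"
      by (simp_all del: fun_upd_apply)
    have wb: "w \<noteq> b" using w(2) by auto
    \<comment> \<open>\<open>F\<close> was completed with the old value at \<open>w\<close>;
      changing it now is harmless, since no vertex of \<open>F\<close> is adjacent to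
      \<open>w\<close>.\<close>
    have F: "inverts_at \<pi> (y(w := c)) u" if "u \<in> F" for u
      using y(3)[OF that] that w by (auto simp: inverts_at_def N_sym)
    have "inverts_at \<pi> (y(w := c)) b"
      unfolding inverts_at_def
    proof
      fix v assume v: "v \<in> N b"
      then have "v \<noteq> b" by auto
      consider "v \<in> F" | "v = w" | "v \<in> N b - F - {w}" using v by auto
      then show "\<pi> {b, v} = scalar_product ((y(w := c)) b) ((y(w := c)) v)"
      proof cases
        case 1
        then show ?thesis using F v by (blast intro: inverts_at_sym)
      next
        case 2
        then show ?thesis using a(3) wb y(2)[OF b] by (simp add: scalar_product_commute)
      next
        case 3
        then show ?thesis using A(2)[OF a(1)] wb y(2)[of v] y(2)[OF b] \<open>v \<noteq> b\<close> by auto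
      qed
    qed
    then show ?thesis using F y c wb w(1) by (intro exI[of _ "y(w := c)"]) auto
  qed
  ultimately show "\<exists>Z. card Z \<le> j \<and> (\<forall>a. a \<noteq> 0 \<longrightarrow> a \<notin> Z \<longrightarrow>
     (\<exists>x'. (\<forall>v. x' v \<noteq> 0) \<and> (\<forall>v. v \<notin> insert b F \<longrightarrow> x' v = (x(w := a)) v) \<and>
       (\<forall>u\<in>insert b F. inverts_at \<pi> x' u)))" by blast
qed

end

section \<open>Counting blocked values along branches\<close>

context girth7_graph
begin

text \<open>The set \<open>F\<close> is hidden, so that later arguments handle only the depth
  \<open>n\<close> and the number \<open>k\<close> of blocked values.\<close>

definition pendant :: "('a set \<Rightarrow> bit) \<Rightarrow> nat \<Rightarrow> nat \<Rightarrow> 'a \<Rightarrow> 'a \<Rightarrow> bool" where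
  "pendant \<pi> n k w y \<longleftrightarrow> y \<in> N w \<and> (\<exists>F. y \<in> F \<and> branch n w y F \<and> blocks \<pi> F w k)"

lemma pendant_mono: "pendant \<pi> n k w y \<Longrightarrow> n \<le> m \<Longrightarrow> pendant \<pi> m k w y"
  unfolding pendant_def using branch_mono by blast

text \<open>Two branches of depth 3 at a common vertex could still be joined by an edge, closing a 7-cycle.
  Their deepest vertices have degree 2, so this is impossible once adjacent 2-vertices are excluded, and the
  exclusion of these uses a single branch only.\<close>

definition separated :: "'a set \<Rightarrow> bool" where
  "separated C \<longleftrightarrow> card C \<le> 1 \<or> (\<forall>u v. v \<in> N u \<longrightarrow> \<not> (card (N u) = 2 \<and> card (N v) = 2))"

lemma pendants_join:
  assumes C: "\<And>c. c \<in> C \<Longrightarrow> pendant \<pi> n (k c) b c" and n: "n \<le> 3" and sep: "separated C"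
  obtains F where "\<And>c. c \<in> C \<Longrightarrow> c \<in> F c \<and> branch n b c (F c)"
    "blocks \<pi> (\<Union>c\<in>C. F c) b (\<Sum>c\<in>C. k c)"
proof -
  have CN: "C \<subseteq> N b" using C by (auto simp: pendant_def)
  then have fin: "finite C" by (rule finite_subset) simp
  have "\<forall>c\<in>C. \<exists>F. c \<in> F \<and> branch n b c F \<and> blocks \<pi> F b (k c)"
    using C by (simp add: pendant_def)
  then obtain F where F: "\<And>c. c \<in> C \<Longrightarrow> c \<in> F c \<and> branch n b c (F c) \<and> blocks \<pi> (F c) b (k c)"
    by (metis bchoice)
  have "blocks \<pi> (\<Union>c\<in>C. F c) b (\<Sum>c\<in>C. k c)"
  proof (rule blocks_UN[OF fin])
    show "blocks \<pi> (F c) b (k c)" if "c \<in> C" for c using F that by simp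
    fix c c' v v' assume c: "c \<in> C" "c' \<in> C" "c \<noteq> c'" "v \<in> F c" "v' \<in> F c'"
    have br: "branch 3 b c (F c)" "branch 3 b c' (F c')"
      using F c n branch_mono by blast+
    have "\<not> card C \<le> 1" using c(1-3) fin card_le_Suc0_iff_eq[of C] by auto
    then have "v' \<in> N v \<longrightarrow> \<not> (card (N v) = 2 \<and> card (N v') = 2)" using sep by (simp add: separated_def)
    then show "v \<noteq> v' \<and> v' \<notin> N v"
      using branches_disjoint[OF br c(3-5)] by (auto simp: N_def)
  qed
  with F that show thesis by blast
qed

text \<open>The bookkeeping rule of all reductions: \<open>b\<close> has 7 values if its neighbours
  other than \<open>w\<close> are all deleted, 3 if one of them stays; the branches in
  \<open>C\<close> block some, \<open>m\<close> remain, and \<open>b\<close> then blocks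
  \<open>j\<close> values of \<open>w\<close>.\<close>

lemma pendant_step:
  assumes w: "b \<in> N w" and C: "\<And>c. c \<in> C \<Longrightarrow> pendant \<pi> n (k c) b c" and wC: "w \<notin> C"
    and n: "n \<le> 3" and sep: "separated C" and leaf: "0 < n \<or> card (N b) = 2"
    and outer: "N b = insert w C \<and> (\<Sum>c\<in>C. k c) + m \<le> 7 \<or>
      (\<exists>u. N b = insert w (insert u C) \<and> u \<notin> C \<and> u \<noteq> w \<and> (\<Sum>c\<in>C. k c) + m \<le> 3)"
    and m: "j = 1 \<and> 3 \<le> m \<or> j = 2 \<and> 2 \<le> m"
  shows "pendant \<pi> (Suc n) j w b"
proof -
  obtain F where F: "\<And>c. c \<in> C \<Longrightarrow> c \<in> F c \<and> branch n b c (F c)"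
    and pF: "blocks \<pi> (\<Union>c\<in>C. F c) b (\<Sum>c\<in>C. k c)"
    using pendants_join[OF C n sep] by metis
  define FF where "FF = (\<Union>c\<in>C. F c)"
  have wb: "w \<in> N b" using w N_sym by simp
  have br: "branch (Suc n) w b (insert b FF)"
    unfolding FF_def using F wC by (intro branch_step[OF w _ leaf]) auto
  have n4: "n \<le> 4" "n \<le> 6" using n by auto
  have bF: "b \<notin> FF" using F branch_not_center[OF _ n4(2)] by (auto simp: FF_def)
  have oF: "u \<notin> FF" "v \<in> FF \<Longrightarrow> v \<notin> N u" if "u \<in> N b" "u \<notin> C" for u v
    using F that branch_nonadjacent[OF _ n4(1) that(1)] unfolding FF_def by fastforce+
  have "blocks \<pi> (insert b FF) w j"
  proof (rule blocks_parent[OF pF[folded FF_def] bF oF(1)[OF wb wC] w oF(2)[OF wb wC] _ m])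
    fix x :: "'a \<Rightarrow> bit^3" assume x: "\<forall>v. x v \<noteq> 0"
    from outer show "\<exists>A. (\<Sum>c\<in>C. k c) + m \<le> card A \<and>
        (\<forall>a\<in>A. a \<noteq> 0 \<and> (\<forall>v\<in>N b - FF - {w}. \<pi> {b, v} = scalar_product a (x v)))"
    proof (elim disjE exE conjE)
      assume "N b = insert w C" "(\<Sum>c\<in>C. k c) + m \<le> 7"
      moreover from this(1) have "N b - FF - {w} = {}" using F by (auto simp: FF_def)
      ultimately show ?thesis using card_nonzero by (intro exI[of _ "{a. a \<noteq> 0}"]) auto
    next
      fix u assume u: "N b = insert w (insert u C)" "u \<notin> C" "u \<noteq> w" "(\<Sum>c\<in>C. k c) + m \<le> 3"
      from this(1) have "N b - FF - {w} \<subseteq> {u}" using F by (auto simp: FF_def)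
      then show ?thesis using u(4) card_hyperplane[of "x u" "\<pi> {b, u}"] x
        by (intro exI[of _ "{a. a \<noteq> 0 \<and> scalar_product a (x u) = \<pi> {b, u}}"]) auto
    qed
  qed
  with br w show ?thesis unfolding pendant_def by blast
qed

text \<open>The same balance at the root of the configuration, where one remaining value is
  enough.\<close>

lemma center_extendable:
  assumes C: "\<And>c. c \<in> C \<Longrightarrow> pendant \<pi> 3 (k c) b c" and sep: "separated C"
    and outer: "N b = C \<and> (\<Sum>c\<in>C. k c) < 7 \<or>
      (\<exists>u. N b = insert u C \<and> u \<notin> C \<and> (\<Sum>c\<in>C. k c) < 3)"
  shows "\<exists>S. b \<in> S \<and> extendable \<pi> S"
proof -
  obtain F where F: "\<And>c. c \<in> C \<Longrightarrow> c \<in> F c \<and> branch 3 b c (F c)"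
    and pF: "blocks \<pi> (\<Union>c\<in>C. F c) b (\<Sum>c\<in>C. k c)"
    using pendants_join[OF C _ sep] by (metis order_refl)
  define FF where "FF = (\<Union>c\<in>C. F c)"
  have bF: "b \<notin> FF" using F branch_not_center by (fastforce simp: FF_def)
  have "extendable \<pi> (insert b FF)"
  proof (rule extendable_center[OF pF[folded FF_def] bF])
    fix x :: "'a \<Rightarrow> bit^3" assume x: "\<forall>v. x v \<noteq> 0"
    from outer show "\<exists>A. (\<Sum>c\<in>C. k c) < card A \<and>
        (\<forall>a\<in>A. a \<noteq> 0 \<and> (\<forall>v\<in>N b - FF. \<pi> {b, v} = scalar_product a (x v)))"
    proof (elim disjE exE conjE)
      assume "N b = C" "(\<Sum>c\<in>C. k c) < 7"
      moreover from this(1) have "N b - FF = {}" using F by (auto simp: FF_def)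
      ultimately show ?thesis using card_nonzero by (intro exI[of _ "{a. a \<noteq> 0}"]) auto
    next
      fix u assume u: "N b = insert u C" "u \<notin> C" "(\<Sum>c\<in>C. k c) < 3"
      from this(1) have "N b - FF \<subseteq> {u}" using F by (auto simp: FF_def)
      then show ?thesis using u(3) card_hyperplane[of "x u" "\<pi> {b, u}"] x
        by (intro exI[of _ "{a. a \<noteq> 0 \<and> scalar_product a (x u) = \<pi> {b, u}}"]) auto
    qed
  qed
  then show ?thesis by blast
qed

end

section \<open>Structure of a minimal counterexample\<close>

lemma card_3_elims:
  assumes "card S = 3" "a \<in> S" "b \<in> S" "a \<noteq> b"
  obtains c where "S = {a, b, c}" "c \<noteq> a" "c \<noteq> b"
proof -
  have "card (S - {a, b}) = 1" using assms by (simp add: card_Diff_subset)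
  then obtain c where c: "S - {a, b} = {c}" by (auto simp: card_1_singleton_iff)
  then have "S = {a, b, c}" "c \<noteq> a" "c \<noteq> b" using assms by auto
  then show thesis by (rule that)
qed

text \<open>Minimality enters only in this form. The vertex \<open>b\<close> ensures that deleting
  \<open>S\<close> really shrinks \<open>V\<close>.\<close>

locale critical = girth7_graph +
  fixes \<pi> :: "'a set \<Rightarrow> bit"
  assumes irreducible: "b \<in> V \<Longrightarrow> b \<in> S \<Longrightarrow> \<not> extendable \<pi> S"
begin

lemma center_all:
  assumes "b \<in> V" "\<And>c. c \<in> N b \<Longrightarrow> pendant \<pi> 3 (k c) b c" "separated (N b)"
  shows "7 \<le> (\<Sum>c\<in>N b. k c)"
  using center_extendable[of "N b" \<pi> k b] assms irreducible by (meson not_le)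

lemma center_outer:
  assumes "b \<in> V" "u \<in> N b" "\<And>c. c \<in> N b - {u} \<Longrightarrow> pendant \<pi> 3 (k c) b c" "separated (N b - {u})"
  shows "3 \<le> (\<Sum>c\<in>N b - {u}. k c)"
proof (rule ccontr)
  assume "\<not> ?thesis"
  then have "N b = insert u (N b - {u}) \<and> u \<notin> N b - {u} \<and> (\<Sum>c\<in>N b - {u}. k c) < 3"
    using assms(2) by auto
  with center_extendable[of "N b - {u}" \<pi> k b] assms irreducible show False by meson
qed

lemma degree_ge_2: assumes "b \<in> V" shows "2 \<le> card (N b)"
proof (rule ccontr)
  assume "\<not> ?thesis"
  then consider "card (N b) = 0" | "card (N b) = 1" by linarith
  then show False
  proof cases
    case 1
    then have "N b = {}" by simp
    with center_all[OF assms, of "\<lambda>_. 0"] show False by (simp add: separated_def)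
  next
    case 2
    then obtain u where "N b = {u}" by (auto simp: card_1_singleton_iff)
    with center_outer[OF assms, of u "\<lambda>_. 0"] show False by (simp add: separated_def)
  qed
qed

text \<open>The other neighbour stays, so three values remain and one is blocked.\<close>

lemma pendant_2_vertex:
  assumes "y \<in> N w" "card (N y) = 2" shows "pendant \<pi> 1 1 w y"
proof -
  have "w \<in> N y" using assms N_sym by simp
  with assms(2) obtain u where "N y = {w, u}" "u \<noteq> w" by (auto simp: card_2_iff doubleton_eq_iff)
  then have "pendant \<pi> (Suc 0) 1 w y"
    by (intro pendant_step[where C = "{}" and m = 3 and k = "\<lambda>_. 0"] assms)
      (use assms in \<open>auto simp: separated_def\<close>)
  then show ?thesis by simp
qed

text \<open>With \<open>z\<close> kept, \<open>v\<close> blocks one of the three values of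
  \<open>u\<close>. Only one branch hangs at \<open>u\<close>, so \<open>separated\<close> holds
  trivially and there is no circularity.\<close>

lemma no_adjacent_2_vertices:
  assumes "v \<in> N u" "card (N u) = 2" "card (N v) = 2" shows False
proof -
  obtain z where z: "N u = {v, z}" "z \<noteq> v"
    using assms(1,2) by (auto simp: card_2_iff doubleton_eq_iff)
  have d: "N u - {z} = {v}" using z by auto
  have "u \<in> V" using assms(1) by (auto simp: N_def dest: edgeD)
  moreover have "pendant \<pi> 3 1 u v" using pendant_mono[OF pendant_2_vertex[OF assms(1,3)], of 3] by simp
  ultimately have "3 \<le> (\<Sum>c\<in>N u - {z}. 1 :: nat)"
    using z(1) by (intro center_outer) (unfold d, auto simp: separated_def)
  then show False by (simp add: d)
qed

lemma separated: "separated C"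
  using no_adjacent_2_vertices by (auto simp: separated_def)

lemmas center_all' = center_all[OF _ _ separated]
lemmas center_outer' = center_outer[OF _ _ _ separated]

text \<open>The initial charge of a vertex of degree \<open>d\<close> is \<open>10d - 28\<close>. A bad vertex starts with 2 and
  gives 4 to its 2-vertex. It recovers the missing 2 from its two other neighbours in equal parts, unless one of
  these is bad as well; then it is strong, blocks only one value at its third neighbour, and that neighbour pays
  everything. A mixed vertex pays 2 to a strong and 1 to a weak bad neighbour, and recovers 1 from
  its third neighbour.\<close>

definition N2 :: "'a \<Rightarrow> 'a set" where "N2 v = {u \<in> N v. card (N u) = 2}"
definition bad :: "'a \<Rightarrow> bool" where "bad v \<longleftrightarrow> card (N v) = 3 \<and> card (N2 v) = 1"
definition bad_nbrs :: "'a \<Rightarrow> 'a set" where "bad_nbrs v = {u \<in> N v. bad u}"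
definition strong :: "'a \<Rightarrow> bool" where "strong v \<longleftrightarrow> bad v \<and> bad_nbrs v \<noteq> {}"
definition mixed :: "'a \<Rightarrow> bool" where
  "mixed v \<longleftrightarrow> card (N v) = 3 \<and> \<not> bad v \<and> card (bad_nbrs v) = 2 \<and> (\<exists>u\<in>bad_nbrs v. strong u)"

lemma N_in_V: "u \<in> N v \<Longrightarrow> u \<in> V \<and> v \<in> V"
  by (auto simp: N_def dest: edgeD)

lemma finite_N2 [simp]: "finite (N2 v)" and finite_bad_nbrs [simp]: "finite (bad_nbrs v)"
  by (simp_all add: N2_def bad_nbrs_def)

lemma pendant_N2: "u \<in> N2 v \<Longrightarrow> pendant \<pi> 1 1 v u"
  unfolding N2_def by (intro pendant_2_vertex) simp_all

text \<open>Two 2-vertices at a 3-vertex block two of the three values left by the third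
  neighbour.\<close>

lemma N2_empty: assumes "card (N v) = 3" "\<not> bad v" "v \<in> V" shows "N2 v = {}"
proof (rule ccontr)
  assume "N2 v \<noteq> {}"
  then have "card (N2 v) \<noteq> 0" by simp
  moreover have "card (N2 v) \<noteq> 1" using assms by (simp add: bad_def)
  ultimately have "2 \<le> card (N2 v)" by linarith
  then obtain x y where xy: "x \<in> N2 v" "y \<in> N2 v" "x \<noteq> y"
    using card_le_Suc0_iff_eq[of "N2 v"] by fastforce
  then obtain z where z: "N v = {x, y, z}" "z \<noteq> x" "z \<noteq> y"
    using card_3_elims[OF assms(1), of x y] by (auto simp: N2_def)
  have "N v - {z} = {x, y}" using z by auto
  moreover have "pendant \<pi> 3 1 v c" if "c \<in> {x, y}" for c
    using pendant_mono[OF pendant_N2, of c v 3] xy that by auto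
  ultimately have "3 \<le> (\<Sum>c\<in>{x, y}. 1 :: nat)"
    using center_outer'[OF assms(3), of z "\<lambda>_. 1"] z(1) by simp
  then show False using xy(3) by simp
qed

lemma bad_not_2: "bad v \<Longrightarrow> card (N v) \<noteq> 2"
  by (simp add: bad_def)

lemma badE:
  assumes "bad b" "w \<in> N b" "card (N w) \<noteq> 2"
  obtains u z where "N b = {u, w, z}" "N2 b = {u}" "u \<noteq> w" "z \<noteq> u" "z \<noteq> w" "card (N z) \<noteq> 2" "card (N u) = 2"
proof -
  obtain u where u: "N2 b = {u}" using assms by (auto simp: bad_def card_1_singleton_iff)
  have uw: "u \<in> N b" "u \<noteq> w" "card (N u) = 2" using u assms by (auto simp: N2_def)
  obtain z where z: "N b = {u, w, z}" "z \<noteq> u" "z \<noteq> w"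
    using card_3_elims[of "N b" u w] assms uw by (auto simp: bad_def)
  have "z \<notin> N2 b" using u z by auto
  then have "card (N z) \<noteq> 2" using z by (auto simp: N2_def)
  with that u uw z show thesis by metis
qed

text \<open>With \<open>z\<close> kept, three values remain and the 2-vertex blocks one; two
  survivors block two values of \<open>w\<close>.\<close>

lemma pendant_bad:
  assumes "bad b" "b \<in> N w" "card (N w) \<noteq> 2" shows "pendant \<pi> 2 2 w b"
proof -
  have "w \<in> N b" using assms N_sym by simp
  then obtain u z where uz: "N b = {u, w, z}" "N2 b = {u}" "u \<noteq> w" "z \<noteq> u" "z \<noteq> w"
    using badE[OF assms(1) _ assms(3)] by metis
  have "pendant \<pi> (Suc 1) 2 w b"
  proof (rule pendant_step[where C = "{u}" and m = 2 and k = "\<lambda>_. 1"])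
    show "pendant \<pi> 1 1 b c" if "c \<in> {u}" for c using that uz by (intro pendant_N2) simp
    show "N b = insert w {u} \<and> (\<Sum>c\<in>{u}. 1) + 2 \<le> (7::nat) \<or>
      (\<exists>z. N b = insert w (insert z {u}) \<and> z \<notin> {u} \<and> z \<noteq> w \<and> (\<Sum>c\<in>{u}. 1) + 2 \<le> (3::nat))"
      using uz by (intro disjI2 exI[of _ z]) auto
  qed (use assms uz separated in auto)
  then show ?thesis by (simp add: numeral_2_eq_2)
qed

text \<open>Otherwise the neighbours of \<open>b\<close> block at most 1 + 2 + 2 = 5 of its 7
  values.\<close>

lemma bad_one_bad_neighbour:
  assumes "bad b" "x \<in> bad_nbrs b" "y \<in> bad_nbrs b" shows "x = y"
proof (rule ccontr)
  assume xy: "x \<noteq> y"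
  have x: "x \<in> N b" "bad x" and y: "y \<in> N b" "bad y" using assms by (auto simp: bad_nbrs_def)
  obtain u z where uz: "N b = {u, x, z}" "N2 b = {u}" "u \<noteq> x" "z \<noteq> u" "z \<noteq> x" "card (N u) = 2"
    using badE[OF assms(1) x(1) bad_not_2[OF x(2)]] by metis
  have "y = z" using uz y xy bad_not_2 by auto
  have "pendant \<pi> 3 (if c = u then 1 else 2) b c" if "c \<in> N b" for c
  proof (cases "c = u")
    case True
    then show ?thesis using pendant_mono[OF pendant_N2, of u b 3] uz by simp
  next
    case False
    then have "bad c" using that uz x y \<open>y = z\<close> by auto
    moreover have "card (N b) \<noteq> 2" using assms by (simp add: bad_def)
    ultimately show ?thesis using pendant_mono[OF pendant_bad, of c b 3] that False by simp
  qed
  from center_all'[OF _ this] N_in_V[OF x(1)] show False using uz by simp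
qed

text \<open>As \<open>w\<close> is not bad, the bad neighbour of \<open>b\<close> is
  \<open>z\<close>, which is deleted too. Then 7 - 1 - 2 = 4 values survive, enough to block only
  one; without \<open>z\<close> there would be two.\<close>

lemma pendant_strong:
  assumes "strong b" "b \<in> N w" "card (N w) \<noteq> 2" "\<not> bad w" shows "pendant \<pi> 3 1 w b"
proof -
  have b: "bad b" using assms by (simp add: strong_def)
  have "w \<in> N b" using assms N_sym by simp
  then obtain u z where uz: "N b = {u, w, z}" "N2 b = {u}" "u \<noteq> w" "z \<noteq> u" "z \<noteq> w" "card (N u) = 2"
    using badE[OF b _ assms(3)] by metis
  have bz: "bad z" using assms uz bad_not_2 by (auto simp: strong_def bad_nbrs_def)
  have "pendant \<pi> (Suc 2) 1 w b"
  proof (rule pendant_step[where C = "{u, z}" and m = 4 and k = "\<lambda>c. if c = u then 1 else 2"])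
    show "pendant \<pi> 2 (if c = u then 1 else 2) b c" if "c \<in> {u, z}" for c
    proof (cases "c = u")
      case True
      then show ?thesis using pendant_mono[OF pendant_N2, of u b 2] uz by simp
    next
      case False
      then show ?thesis using pendant_bad[OF bz, of b] uz that b by (auto simp: bad_def)
    qed
    show "N b = insert w {u, z} \<and> (\<Sum>c\<in>{u, z}. if c = u then 1 else 2) + 4 \<le> (7::nat) \<or>
      (\<exists>y. N b = insert w (insert y {u, z}) \<and> y \<notin> {u, z} \<and> y \<noteq> w \<and>
        (\<Sum>c\<in>{u, z}. if c = u then 1 else 2) + 4 \<le> (3::nat))"
      using uz by (intro disjI1) auto
  qed (use assms uz separated in auto)
  then show ?thesis by (simp add: numeral_3_eq_3 numeral_2_eq_2)
qed

text \<open>Both bad neighbours are deleted, which leaves 7 - 2 - 2 = 3 values.\<close>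

lemma pendant_mixed:
  assumes "mixed b" "b \<in> N w" "\<not> bad w" shows "pendant \<pi> 3 1 w b"
proof -
  obtain x y where xy: "bad_nbrs b = {x, y}" "x \<noteq> y" using assms by (auto simp: mixed_def card_2_iff)
  have w: "w \<in> N b" "w \<notin> bad_nbrs b" using assms N_sym by (auto simp: bad_nbrs_def)
  have b3: "card (N b) = 3" using assms by (simp add: mixed_def)
  have xyN: "x \<in> N b" "y \<in> N b" "bad x" "bad y" using xy by (auto simp: bad_nbrs_def)
  obtain z where "N b = {x, y, z}" using card_3_elims[OF b3 xyN(1,2) xy(2)] by metis
  then have N: "N b = {w, x, y}" using w xy by auto
  have "pendant \<pi> (Suc 2) 1 w b"
  proof (rule pendant_step[where C = "{x, y}" and m = 3 and k = "\<lambda>_. 2"])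
    show "pendant \<pi> 2 2 b c" if "c \<in> {x, y}" for c
      using that xyN b3 by (intro pendant_bad) auto
    show "N b = insert w {x, y} \<and> (\<Sum>c\<in>{x, y}. 2) + 3 \<le> (7::nat) \<or>
      (\<exists>z. N b = insert w (insert z {x, y}) \<and> z \<notin> {x, y} \<and> z \<noteq> w \<and> (\<Sum>c\<in>{x, y}. 2) + 3 \<le> (3::nat))"
      using N xy by (intro disjI1) auto
  qed (use assms w xy separated in auto)
  then show ?thesis by (simp add: numeral_3_eq_3 numeral_2_eq_2)
qed

section \<open>Discharging\<close>

definition give :: "'a \<Rightarrow> 'a \<Rightarrow> int" where
  "give w y = (if card (N w) = 2 then 0 else if card (N y) = 2 then 4 else if bad w then 0
     else if strong y then 2 else if bad y \<or> mixed y then 1 else 0)"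

text \<open>The number of values blocked by a neighbour that receives charge, see
  \<open>give_pendant\<close>.\<close>

definition weight :: "'a \<Rightarrow> nat" where
  "weight u = (if card (N u) = 2 \<or> strong u \<or> mixed u then 1 else 2)"

lemma give_bounds: "0 \<le> give w y" "give w y \<le> 4" "card (N y) \<noteq> 2 \<Longrightarrow> give w y \<le> 2"
  by (simp_all add: give_def)

text \<open>The link between the two counts: each payment goes to the root of a reducible branch, so
  a vertex that pays too much would block too little.\<close>

lemma give_pendant:
  assumes "u \<in> N v" "\<not> bad v" "give v u \<noteq> 0" shows "pendant \<pi> 3 (weight u) v u"
proof -
  have v2: "card (N v) \<noteq> 2" using assms(3) by (auto simp: give_def)
  consider "card (N u) = 2" | "strong u" "card (N u) \<noteq> 2" | "mixed u" "card (N u) \<noteq> 2"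
    | "bad u" "\<not> strong u" "\<not> mixed u" "card (N u) \<noteq> 2"
    using assms(3) by (auto simp: give_def split: if_splits)
  then show ?thesis
  proof cases
    case 1
    then show ?thesis using pendant_mono[OF pendant_2_vertex[OF assms(1)], of 3] by (simp add: weight_def)
  next
    case 2
    then show ?thesis using pendant_strong[OF _ assms(1) v2 assms(2)] by (simp add: weight_def)
  next
    case 3
    then show ?thesis using pendant_mixed[OF _ assms(1,2)] by (simp add: weight_def)
  next
    case 4
    then show ?thesis using pendant_mono[OF pendant_bad[OF _ assms(1) v2], of 3] by (simp add: weight_def)
  qed
qed

text \<open>The initial charge is -8 in degree 2, covered by 4 from each side, then 2 in degree 3
  and 12 in degree 4. From degree 5 on, 10d - 28 exceeds the maximal payment 4d.\<close>

lemma final_charge: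
  assumes v: "v \<in> V"
  shows "28 + (\<Sum>u\<in>N v. give v u) \<le> 10 * int (card (N v)) + (\<Sum>u\<in>N v. give u v)"
proof -
  have pos: "0 \<le> (\<Sum>u\<in>N v. give u v)" by (intro sum_nonneg give_bounds)
  consider "card (N v) = 2" | "bad v" | "card (N v) = 3" "\<not> bad v" | "card (N v) = 4" | "5 \<le> card (N v)"
    using degree_ge_2[OF v] by linarith
  then show ?thesis
  proof cases
    case 1
    then obtain x y where xy: "N v = {x, y}" "x \<noteq> y" by (auto simp: card_2_iff)
    have "card (N x) \<noteq> 2" "card (N y) \<noteq> 2"
      using no_adjacent_2_vertices[of _ v] xy 1 by auto
    then show ?thesis using 1 xy by (simp add: give_def)
  next
    case 2
    then have 3: "card (N v) = 3" by (simp add: bad_def)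
    show ?thesis
    \<comment> \<open>A bad vertex needs 2 after paying its 2-vertex: all from \<open>z\<close> if
      it is strong, 1 each from two vertices that are not bad otherwise.\<close>
    proof (cases "strong v")
      case True
      then obtain m where m: "m \<in> bad_nbrs v" by (auto simp: strong_def)
      then have mN: "m \<in> N v" "bad m" by (auto simp: bad_nbrs_def)
      obtain u z where uz: "N v = {u, m, z}" "N2 v = {u}" "u \<noteq> m" "z \<noteq> u" "z \<noteq> m"
          "card (N z) \<noteq> 2" "card (N u) = 2"
        using badE[OF 2 mN(1) bad_not_2[OF mN(2)]] by metis
      have "\<not> bad z" using bad_one_bad_neighbour[OF 2 m, of z] uz by (auto simp: bad_nbrs_def)
      then show ?thesis using uz 2 3 mN True by (simp add: give_def bad_not_2)
    next
      case False
      have "\<not> N v \<subseteq> N2 v"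
        using 2 3 card_mono[of "N2 v" "N v"] by (auto simp: bad_def)
      then obtain w where w: "w \<in> N v" "card (N w) \<noteq> 2" by (auto simp: N2_def)
      obtain u z where uz: "N v = {u, w, z}" "N2 v = {u}" "u \<noteq> w" "z \<noteq> u" "z \<noteq> w"
          "card (N z) \<noteq> 2" "card (N u) = 2"
        using badE[OF 2 w] by metis
      have "\<not> bad z" "\<not> bad w" using False 2 uz by (auto simp: strong_def bad_nbrs_def)
      then show ?thesis using uz 2 3 w False by (simp add: give_def)
    qed
  next
    case 3
    have T: "card (N u) \<noteq> 2" if "u \<in> N v" for u using N2_empty[OF 3 v] that by (auto simp: N2_def)
    \<comment> \<open>\<open>c\<close> is a neighbour that receives nothing; of the other two,
      \<open>a\<close> receives at least as much as \<open>b\<close>.\<close>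
    have *: ?thesis if N: "N v = {a, b, c}" "a \<noteq> b" "c \<noteq> a" "c \<noteq> b" and c: "give v c = 0"
      and ab: "give v b \<le> give v a" for a b c
    proof -
      have s: "(\<Sum>u\<in>N v. give v u) = give v a + give v b" using N c by simp
      show ?thesis
      proof (cases "give v a = 2 \<and> give v b \<noteq> 0")
        case False
        have "give v a \<le> 2" "give v b \<le> 2" using T N give_bounds(3) by auto
        then show ?thesis using False s pos ab 3 give_bounds(1)[of v b] by auto
      next
        \<comment> \<open>Only here can the payments exceed 2. Since \<open>a\<close> is strong and
          blocks one value, \<open>b\<close> must block two of the three left by \<open>c\<close>;
          so \<open>b\<close> is bad but not strong and gets 1. Hence \<open>v\<close> is mixed, and
          \<open>c\<close> returns the missing 1.\<close>
        case True
        then have a: "strong a" using T N 3 by (auto simp: give_def split: if_splits)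
        have Nc: "N v - {c} = {a, b}" using N by auto
        have "pendant \<pi> 3 (weight u) v u" if "u \<in> {a, b}" for u
          using that True N 3 by (intro give_pendant) auto
        then have "3 \<le> (\<Sum>u\<in>{a, b}. weight u)"
          using center_outer'[OF v, of c weight, unfolded Nc] N(1) by simp
        then have "weight b \<noteq> 1" using N(2) a by (simp add: weight_def)
        then have b: "bad b" "give v b = 1"
          using True T N 3 by (auto simp: weight_def give_def split: if_splits)
        have cb: "\<not> bad c" using c T N 3 by (auto simp: give_def split: if_splits)
        have "bad_nbrs v = {a, b}" using a b cb N by (auto simp: bad_nbrs_def strong_def)
        then have "mixed v" using 3 a N(2) by (auto simp: mixed_def)
        then have "give c v = 1" using cb T N 3 by (auto simp: give_def strong_def)
        moreover have "(\<Sum>u\<in>N v. give u v) = give a v + give b v + give c v" using N by simp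
        ultimately show ?thesis using s True b(2) 3 give_bounds(1)[of a v] give_bounds(1)[of b v] by simp
      qed
    qed
    \<comment> \<open>Three paid neighbours would block at most 6 of the 7 values.\<close>
    have "\<exists>c\<in>N v. give v c = 0"
    proof (rule ccontr)
      assume "\<not> ?thesis"
      then have "pendant \<pi> 3 (weight u) v u" if "u \<in> N v" for u
        using that 3 by (intro give_pendant) auto
      from center_all'[OF v this] have "7 \<le> (\<Sum>u\<in>N v. weight u)" .
      also have "\<dots> \<le> (\<Sum>u\<in>N v. 2)" by (intro sum_mono) (simp add: weight_def)
      finally show False using 3 by simp
    qed
    then obtain c where c: "c \<in> N v" "give v c = 0" by blast
    have "card (N v - {c}) = 2" using c 3 by simp
    then obtain a b where "N v - {c} = {a, b}" "a \<noteq> b" by (auto simp: card_2_iff)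
    then have "N v = {a, b, c}" "N v = {b, a, c}" "a \<noteq> b" "b \<noteq> a" "c \<noteq> a" "c \<noteq> b" using c by auto
    then show ?thesis using *[of a b c] *[of b a c] c(2) by linarith
  next
    case 4
    have nb: "\<not> bad v" using 4 by (simp add: bad_def)
    \<comment> \<open>If some neighbour gets nothing, at most three payments of 4 occur. Otherwise
      the weights must reach 7 out of 8, so at most one neighbour is a 2-vertex and at most 4 + 3
      times 2 is paid.\<close>
    have "(\<Sum>u\<in>N v. give v u) \<le> 12"
    proof (cases "\<exists>c\<in>N v. give v c = 0")
      case True
      then obtain c where c: "c \<in> N v" "give v c = 0" by blast
      then have "(\<Sum>u\<in>N v. give v u) = (\<Sum>u\<in>N v - {c}. give v u)" by (simp add: sum.remove)
      also have "\<dots> \<le> (\<Sum>u\<in>N v - {c}. 4)" by (intro sum_mono give_bounds)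
      finally show ?thesis using c 4 by simp
    next
      case False
      then have "pendant \<pi> 3 (weight u) v u" if "u \<in> N v" for u
        using that nb by (intro give_pendant) auto
      from center_all'[OF v this] have "7 \<le> (\<Sum>u\<in>N v. weight u)" .
      also have "\<dots> \<le> (\<Sum>u\<in>N v. if u \<in> N2 v then 1 else 2)"
        by (intro sum_mono) (simp add: weight_def N2_def)
      also have "\<dots> = card (N2 v) + 2 * card (N v - N2 v)"
        by (subst sum.If_cases) (auto simp: N2_def Int_def intro!: arg_cong[where f = card])
      also have "card (N v - N2 v) = 4 - card (N2 v)"
        using 4 by (subst card_Diff_subset) (auto simp: N2_def)
      finally have t: "card (N2 v) \<le> 1" using card_mono[of "N v" "N2 v"] 4 by (auto simp: N2_def)
      have "(\<Sum>u\<in>N v. give v u) \<le> (\<Sum>u\<in>N v. if u \<in> N2 v then 4 else 2)"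
        by (intro sum_mono) (auto simp: N2_def intro: give_bounds)
      also have "\<dots> = 4 * int (card (N2 v)) + 2 * int (card (N v - N2 v))"
        by (subst sum.If_cases) (auto simp: N2_def Int_def intro!: arg_cong[where f = card])
      also have "card (N v - N2 v) = 4 - card (N2 v)"
        using 4 by (subst card_Diff_subset) (auto simp: N2_def)
      finally show ?thesis using t by simp
    qed
    then show ?thesis using 4 pos by simp
  next
    case 5
    have "(\<Sum>u\<in>N v. give v u) \<le> (\<Sum>u\<in>N v. 4)" by (intro sum_mono give_bounds)
    then show ?thesis using 5 pos by simp
  qed
qed

lemma sum_degrees: "(\<Sum>v\<in>V. card (N v)) = 2 * card E"
proof -
  have E: "finite E" "\<And>e. e \<in> E \<Longrightarrow> e \<subseteq> V \<and> card e = 2"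
    using graph finite_subset[of E "Pow V"] by (auto simp: finite_simple_graph_def)
  have "card (N v) = card {e \<in> E. v \<in> e}" for v
  proof (rule bij_betw_same_card)
    show "bij_betw (\<lambda>u. {v, u}) (N v) {e \<in> E. v \<in> e}"
      unfolding bij_betw_def
    proof
      show "inj_on (\<lambda>u. {v, u}) (N v)" by (auto simp: inj_on_def doubleton_eq_iff)
      show "(\<lambda>u. {v, u}) ` N v = {e \<in> E. v \<in> e}"
      proof (intro equalityI subsetI)
        fix e assume e: "e \<in> {e \<in> E. v \<in> e}"
        then have "card e = 2" using E by auto
        with e obtain u where "e = {v, u}" by (auto simp: card_2_iff)
        then show "e \<in> (\<lambda>u. {v, u}) ` N v" using e by (auto simp: N_def)
      qed (auto simp: N_def)
    qed
  qed
  then have "(\<Sum>v\<in>V. card (N v)) = (\<Sum>v\<in>V. \<Sum>e\<in>{e\<in>E. v \<in> e}. 1)" by simp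
  also have "\<dots> = (\<Sum>e\<in>E. \<Sum>v\<in>{v\<in>V. v \<in> e}. 1)"
    by (rule sum.swap_restrict[OF finite_V E(1)])
  also have "\<dots> = (\<Sum>e\<in>E. 2)"
  proof (rule sum.cong)
    fix e assume "e \<in> E"
    then have "{v \<in> V. v \<in> e} = e" "card e = 2" using E(2) by auto
    then show "(\<Sum>v\<in>{v\<in>V. v \<in> e}. 1) = (2::nat)" by simp
  qed simp
  finally show ?thesis by simp
qed

text \<open>Each payment is counted once as given and once as received, so summing the final charges
  leaves 28|V| <= 20|E|.\<close>

lemma dense: "7 * card V \<le> 5 * card E"
proof -
  have "(\<Sum>v\<in>V. \<Sum>u\<in>N v. give v u) = (\<Sum>v\<in>V. \<Sum>u\<in>{u\<in>V. u \<in> N v}. give v u)"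
    using N_subset by (intro sum.cong refl) auto
  also have "\<dots> = (\<Sum>u\<in>V. \<Sum>v\<in>{v\<in>V. u \<in> N v}. give v u)"
    by (rule sum.swap_restrict[OF finite_V finite_V])
  also have "\<dots> = (\<Sum>u\<in>V. \<Sum>v\<in>N u. give v u)"
    using N_subset N_sym by (intro sum.cong refl) auto
  finally have sym: "(\<Sum>v\<in>V. \<Sum>u\<in>N v. give v u) = (\<Sum>v\<in>V. \<Sum>u\<in>N v. give u v)" .
  have "(\<Sum>v\<in>V. 28 + (\<Sum>u\<in>N v. give v u)) \<le> (\<Sum>v\<in>V. 10 * int (card (N v)) + (\<Sum>u\<in>N v. give u v))"
    by (intro sum_mono final_charge)
  then have "28 * int (card V) \<le> 10 * (\<Sum>v\<in>V. int (card (N v)))"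
    using sym by (simp add: sum.distrib sum_distrib_left)
  also have "(\<Sum>v\<in>V. int (card (N v))) = int (\<Sum>v\<in>V. card (N v))" by simp
  finally show ?thesis unfolding sum_degrees by simp
qed

end

text \<open>Sparsity is assumed for all subgraphs so that it survives the deletion of
  \<open>S\<close>; apart from this and the girth, nothing about planarity is needed for the
  colouring.\<close>

lemma sparse_strict_inversion:
  fixes \<pi> :: "'a set \<Rightarrow> bit"
  assumes "finite_simple_graph V E"
    and "\<And>c. distinct c \<Longrightarrow> 3 \<le> length c \<Longrightarrow> cedges c \<subseteq> E \<Longrightarrow> 7 \<le> length c"
    and "\<And>V' E'. V' \<subseteq> V \<Longrightarrow> E' \<subseteq> E \<Longrightarrow> \<Union> E' \<subseteq> V' \<Longrightarrow> V' \<noteq> {} \<Longrightarrow> 5 * card E' < 7 * card V'"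
  shows "\<exists>x :: 'a \<Rightarrow> bit ^ 3. strict_inversion V E \<pi> x"
  using assms
proof (induction "card V" arbitrary: V E rule: less_induct)
  case less
  interpret girth7_graph V E using less.prems(1,2) by unfold_locales
  show ?case
  proof (cases "V = {}")
    case True
    then have "{u, v} \<notin> E" for u v using edgeD(1)[of u v] by auto
    with True show ?thesis by (auto simp: strict_inversion_def inversion_def)
  next
    case False
    have "\<not> critical V E \<pi>"
    proof
      assume "critical V E \<pi>"
      then interpret critical V E \<pi> .
      have "\<Union> E \<subseteq> V" using graph by (auto simp: finite_simple_graph_def)
      then show False using dense less.prems(3)[of V E] False by simp
    qed
    then obtain b S where S: "b \<in> V" "b \<in> S" "extendable \<pi> S"
      unfolding critical_def critical_axioms_def using girth7_graph_axioms by blast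
    define V' where "V' = V - S"
    define E' where "E' = {e \<in> E. e \<inter> S = {}}"
    have 1: "card V' < card V" unfolding V'_def by (rule psubset_card_mono[OF finite_V]) (use S in auto)
    have 2: "finite_simple_graph V' E'" using graph by (auto simp: finite_simple_graph_def V'_def E'_def)
    have 3: "7 \<le> length c" if "distinct c" "3 \<le> length c" "cedges c \<subseteq> E'" for c
      using that by (intro girth7) (auto simp: E'_def)
    have 4: "5 * card E'' < 7 * card V''"
      if "V'' \<subseteq> V'" "E'' \<subseteq> E'" "\<Union> E'' \<subseteq> V''" "V'' \<noteq> {}" for V'' E''
      using that by (intro less.prems(3)) (auto simp: V'_def E'_def)
    obtain x0 :: "'a \<Rightarrow> bit^3" where x0: "strict_inversion V' E' \<pi> x0"
      using less.hyps[OF 1 2 3 4] by blast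
    \<comment> \<open>The all-ones vector is an arbitrary nonzero default: \<open>extendable\<close>
      expects a nowhere zero assignment on the whole type, and \<open>S\<close> is reassigned
      anyway.\<close>
    define x where "x v = (if v \<in> V' then x0 v else 1)" for v
    have x: "x v \<noteq> 0" for v using x0 by (simp add: x_def strict_inversion_def vec_eq_iff)
    obtain y where y: "\<forall>v. y v \<noteq> 0" "\<forall>v. v \<notin> S \<longrightarrow> y v = x v" "\<forall>u\<in>S. inverts_at \<pi> y u"
      using S(3)[unfolded extendable_def, THEN spec, of x] x by blast
    have "\<pi> {u, v} = scalar_product (y u) (y v)" if e: "{u, v} \<in> E" for u v
    proof -
      have uv: "v \<in> N u" "u \<in> V" "v \<in> V" using e edgeD by (auto simp: N_def)
      consider "u \<in> S" | "v \<in> S" | "u \<notin> S" "v \<notin> S" by blast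
      then show ?thesis
      proof cases
        case 1
        then show ?thesis using y(3) uv by (auto simp: inverts_at_def)
      next
        case 2
        then show ?thesis using y(3) uv by (intro inverts_at_sym) auto
      next
        case 3
        then have "{u, v} \<in> E'" "u \<in> V'" "v \<in> V'" using e uv by (auto simp: E'_def V'_def)
        then show ?thesis using x0 y(2) 3
          by (simp add: strict_inversion_def inversion_def x_def)
      qed
    qed
    then have "strict_inversion V E \<pi> y" using y(1) by (simp add: strict_inversion_def inversion_def)
    then show ?thesis by blast
  qed
qed

section \<open>Plane drawings\<close>

definition img :: "('a set \<Rightarrow> real \<Rightarrow> complex) \<Rightarrow> 'a set set \<Rightarrow> complex set" where
  "img \<gamma> A = (\<Union>e\<in>A. path_image (\<gamma> e))"

lemma img_Un: "img \<gamma> (A \<union> B) = img \<gamma> A \<union> img \<gamma> B"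
  by (auto simp: img_def)

lemma img_mono: "A \<subseteq> B \<Longrightarrow> img \<gamma> A \<subseteq> img \<gamma> B"
  by (auto simp: img_def)

locale drawing =
  fixes V :: "'a set" and E :: "'a set set" and p :: "'a \<Rightarrow> complex" and \<gamma> :: "'a set \<Rightarrow> real \<Rightarrow> complex"
  assumes graph: "finite_simple_graph V E" and drawing: "plane_drawing V E p \<gamma>"
begin

lemma finite_V: "finite V" and edge: "e \<in> E \<Longrightarrow> e \<subseteq> V" "e \<in> E \<Longrightarrow> card e = 2"
  using graph by (auto simp: finite_simple_graph_def)

lemma finite_E: "finite E"
  using finite_V edge(1) by (meson Pow_iff finite_Pow_iff finite_subset subsetI)

lemma inj_p: "inj_on p V"
  and arc_edge: "e \<in> E \<Longrightarrow> arc (\<gamma> e)"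
  and ends: "e \<in> E \<Longrightarrow> {pathstart (\<gamma> e), pathfinish (\<gamma> e)} = p ` e"
  and edge_vertices: "e \<in> E \<Longrightarrow> path_image (\<gamma> e) \<inter> p ` V = p ` e"
  and edges_meet: "e \<in> E \<Longrightarrow> f \<in> E \<Longrightarrow> e \<noteq> f \<Longrightarrow> path_image (\<gamma> e) \<inter> path_image (\<gamma> f) = p ` (e \<inter> f)"
  using drawing unfolding plane_drawing_def by blast+

lemma subdrawing:
  assumes "V' \<subseteq> V" "E' \<subseteq> E" "\<Union> E' \<subseteq> V'"
  shows "drawing V' E' p \<gamma>"
proof
  show "finite_simple_graph V' E'"
    using finite_V edge assms by (auto simp: finite_simple_graph_def intro: finite_subset)
  have "path_image (\<gamma> e) \<inter> p ` V' = p ` e" if "e \<in> E'" for e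
    using edge_vertices[of e] assms that by blast
  then show "plane_drawing V' E' p \<gamma>"
    using assms inj_p arc_edge ends edges_meet unfolding plane_drawing_def
    by (metis inj_on_subset subset_eq)
qed

lemma img_Int:
  assumes "A \<subseteq> E" "B \<subseteq> E" "A \<inter> B = {}"
  shows "img \<gamma> A \<inter> img \<gamma> B = p ` (\<Union> A \<inter> \<Union> B)"
proof -
  have "img \<gamma> A \<inter> img \<gamma> B = (\<Union>e\<in>A. \<Union>f\<in>B. path_image (\<gamma> e) \<inter> path_image (\<gamma> f))"
    by (auto simp: img_def)
  also have "\<dots> = (\<Union>e\<in>A. \<Union>f\<in>B. p ` (e \<inter> f))"
    using assms edges_meet by (intro SUP_cong refl) blast
  also have "\<dots> = p ` (\<Union> A \<inter> \<Union> B)" by blast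
  finally show ?thesis .
qed

lemma edge_image_not_finite: assumes "e \<in> E" shows "\<not> finite (path_image (\<gamma> e))"
proof -
  have "\<not> finite {0..1::real}" by simp
  then show ?thesis using arc_edge[OF assms] finite_imageD unfolding arc_def path_image_def by blast
qed

text \<open>A foreign edge meets \<open>img \<gamma> A\<close> only in images of its ends, but an
  arc is infinite.\<close>

lemma edge_subset_img:
  assumes "e \<in> E" "A \<subseteq> E" "path_image (\<gamma> e) \<subseteq> img \<gamma> A" shows "e \<in> A"
proof (rule ccontr)
  assume "e \<notin> A"
  then have "img \<gamma> {e} \<inter> img \<gamma> A = p ` (\<Union> {e} \<inter> \<Union> A)" using assms by (intro img_Int) auto
  then have "path_image (\<gamma> e) \<subseteq> p ` e" using assms(3) by (auto simp: img_def)
  moreover have "finite (p ` e)" using edge(1)[OF assms(1)] finite_V finite_subset by blast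
  ultimately show False using edge_image_not_finite[OF assms(1)] finite_subset by blast
qed

lemma vertex_in_img:
  assumes "A \<subseteq> E" shows "{v \<in> V. p v \<in> img \<gamma> A} = \<Union> A"
proof (intro equalityI subsetI)
  fix v assume "v \<in> {v \<in> V. p v \<in> img \<gamma> A}"
  then obtain e where e: "v \<in> V" "e \<in> A" "p v \<in> path_image (\<gamma> e)" by (auto simp: img_def)
  then have "p v \<in> p ` e" using edge_vertices[of e] assms by auto
  then show "v \<in> \<Union> A" using e inj_p edge(1)[of e] assms by (auto simp: inj_on_def)
next
  fix v assume "v \<in> \<Union> A"
  then obtain e where e: "e \<in> A" "v \<in> e" by auto
  then have "p v \<in> path_image (\<gamma> e)" using edge_vertices[of e] assms by auto
  then show "v \<in> {v \<in> V. p v \<in> img \<gamma> A}" using e edge(1) assms by (auto simp: img_def)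
qed

lemma arc_between:
  assumes "{x, y} \<in> E"
  obtains g where "arc g" "pathstart g = p x" "pathfinish g = p y" "path_image g = path_image (\<gamma> {x, y})"
proof -
  have "{pathstart (\<gamma> {x, y}), pathfinish (\<gamma> {x, y})} = {p x, p y}" using ends[OF assms] by simp
  then consider "pathstart (\<gamma> {x, y}) = p x" "pathfinish (\<gamma> {x, y}) = p y"
    | "pathstart (\<gamma> {x, y}) = p y" "pathfinish (\<gamma> {x, y}) = p x"
    by (auto simp: doubleton_eq_iff)
  then show thesis
  proof cases
    case 1
    then show thesis using that[of "\<gamma> {x, y}"] arc_edge[OF assms] by simp
  next
    case 2
    then show thesis using that[of "reversepath (\<gamma> {x, y})"] arc_edge[OF assms]
      by (simp add: arc_reversepath)
  qed
qed

lemma path_arc: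
  assumes "distinct xs" "2 \<le> length xs" "pedges xs \<subseteq> E"
  shows "\<exists>g. arc g \<and> pathstart g = p (hd xs) \<and> pathfinish g = p (last xs) \<and> path_image g = img \<gamma> (pedges xs)"
  using assms
proof (induction xs rule: pedges.induct)
  case (1 x y zs)
  obtain h where h: "arc h" "pathstart h = p x" "pathfinish h = p y" "path_image h = path_image (\<gamma> {x, y})"
    using arc_between[of x y] 1 by auto
  show ?case
  proof (cases zs)
    case Nil
    then show ?thesis using h by (intro exI[of _ h]) (simp add: img_def)
  next
    case (Cons z zs')
    then obtain g where g: "arc g" "pathstart g = p y" "pathfinish g = p (last (y # zs))"
        "path_image g = img \<gamma> (pedges (y # zs))" using 1 by auto
    have "{x, y} \<notin> pedges (y # zs)" using 1 pedges_subset[of "{x, y}" "y # zs"] by auto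
    then have "img \<gamma> {{x, y}} \<inter> img \<gamma> (pedges (y # zs)) = p ` (\<Union> {{x, y}} \<inter> \<Union> (pedges (y # zs)))"
      using 1 by (intro img_Int) auto
    also have "\<Union> {{x, y}} \<inter> \<Union> (pedges (y # zs)) \<subseteq> {y}"
      using 1 pedges_subset[of _ "y # zs"] by auto
    finally have "path_image h \<inter> path_image g \<subseteq> {pathstart g}" using h g by (auto simp: img_def)
    then have "arc (h +++ g)" using h g by (intro arc_join) auto
    then show ?thesis using h g
      by (intro exI[of _ "h +++ g"]) (simp add: path_image_join img_def Cons)
  qed
qed auto

lemma cycle_arcs:
  assumes "distinct (u # as @ v # bs)" "3 \<le> length (u # as @ v # bs)" "cedges (u # as @ v # bs) \<subseteq> E"
  obtains g h where "arc g" "pathstart g = p u" "pathfinish g = p v" "path_image g = img \<gamma> (pedges (u # as @ [v]))"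
    "arc h" "pathstart h = p u" "pathfinish h = p v" "path_image h = img \<gamma> (pedges (u # rev bs @ [v]))"
    "path_image g \<inter> path_image h = {p u, p v}" "p u \<noteq> p v"
proof -
  have E: "pedges (u # as @ [v]) \<subseteq> E" "pedges (u # rev bs @ [v]) \<subseteq> E"
    using assms(3) by (auto simp: cedges_split)
  obtain g where g: "arc g" "pathstart g = p u" "pathfinish g = p v" "path_image g = img \<gamma> (pedges (u # as @ [v]))"
    using path_arc[of "u # as @ [v]"] assms E by auto
  obtain h where h: "arc h" "pathstart h = p u" "pathfinish h = p v" "path_image h = img \<gamma> (pedges (u # rev bs @ [v]))"
    using path_arc[of "u # rev bs @ [v]"] assms E by auto
  have "path_image g \<inter> path_image h = p ` (\<Union> (pedges (u # as @ [v])) \<inter> \<Union> (pedges (u # rev bs @ [v])))"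
    unfolding g h by (rule img_Int[OF E cedges_parts[OF assms(1,2)]])
  also have "\<dots> = p ` (set (u # as @ [v]) \<inter> set (u # rev bs @ [v]))"
    by (subst (1 2) Union_pedges) auto
  also have "set (u # as @ [v]) \<inter> set (u # rev bs @ [v]) = {u, v}" using assms(1) by auto
  finally have "path_image g \<inter> path_image h = {p u, p v}" by simp
  moreover have "p u \<noteq> p v" using g(1-3) arc_distinct_ends by metis
  ultimately show thesis using that g h by blast
qed

lemma cycle_loop:
  assumes "distinct c" "3 \<le> length c" "cedges c \<subseteq> E"
  obtains g where "simple_path g" "pathfinish g = pathstart g" "path_image g = img \<gamma> (cedges c)"
proof -
  obtain u v bs where c: "c = u # [] @ v # bs" using assms(2) by (cases c; cases "tl c") auto
  obtain g h where gh: "arc g" "pathstart g = p u" "pathfinish g = p v" "path_image g = img \<gamma> (pedges (u # [] @ [v]))"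
    "arc h" "pathstart h = p u" "pathfinish h = p v" "path_image h = img \<gamma> (pedges (u # rev bs @ [v]))"
    "path_image g \<inter> path_image h = {p u, p v}"
    using cycle_arcs[OF assms[unfolded c]] by metis
  show thesis
  proof
    show "simple_path (g +++ reversepath h)"
      using gh by (intro simple_path_join_loop) (auto simp: arc_reversepath)
    show "pathfinish (g +++ reversepath h) = pathstart (g +++ reversepath h)" using gh by simp
    show "path_image (g +++ reversepath h) = img \<gamma> (cedges c)"
      using gh unfolding c cedges_split img_Un by (subst path_image_join) auto
  qed
qed

text \<open>The ends are limits of the open arc.\<close>

lemma edge_in_closed:
  assumes "e \<in> E" "closed S" "path_image (\<gamma> e) - p ` e \<subseteq> S"
  shows "path_image (\<gamma> e) \<subseteq> S"
proof -
  have inj: "inj_on (\<gamma> e) {0..1}" and cont: "continuous_on {0..1} (\<gamma> e)"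
    using arc_edge[OF assms(1)] by (auto simp: arc_def path_def)
  have "\<gamma> e t \<in> S" if "t \<in> {0<..<1}" for t
  proof -
    have "\<gamma> e t \<noteq> \<gamma> e 0" "\<gamma> e t \<noteq> \<gamma> e 1"
      using inj_onD[OF inj, of t 0] inj_onD[OF inj, of t 1] that by auto
    then have "\<gamma> e t \<notin> p ` e" using ends[OF assms(1)] by (auto simp: pathstart_def pathfinish_def)
    moreover have "\<gamma> e t \<in> path_image (\<gamma> e)" using that by (auto simp: path_image_def)
    ultimately show ?thesis using assms(3) by auto
  qed
  then have "\<gamma> e ` closure {0<..<1} \<subseteq> S"
    using cont by (intro image_closure_subset[OF _ assms(2)]) auto
  then show ?thesis by (simp add: path_image_def)
qed

lemma open_edge_connected: assumes "e \<in> E" shows "connected (path_image (\<gamma> e) - p ` e)"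
  using connected_simple_path_endless[OF arc_imp_simple_path[OF arc_edge[OF assms]]] ends[OF assms] by simp

text \<open>An edge off the boundary curves is connected apart from its ends and avoids these curves
  there, so it stays in one of the two open regions. The lemma serves two cuts: an ear inside a
  cycle, where \<open>A1\<close> and \<open>A2\<close> share the ear, and a single cycle with its
  inside and outside, where \<open>A1 = A2\<close>.\<close>

lemma region_split:
  fixes A1 A2 X1 X2
  defines "S1 \<equiv> img \<gamma> A1 \<union> X1" and "S2 \<equiv> img \<gamma> A2 \<union> X2"
  defines "V1 \<equiv> {v \<in> V. p v \<in> S1}" and "V2 \<equiv> {v \<in> V. p v \<in> S2}"
  defines "E1 \<equiv> {e \<in> E. path_image (\<gamma> e) \<subseteq> S1}" and "E2 \<equiv> {e \<in> E. path_image (\<gamma> e) \<subseteq> S2}"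
  assumes A: "A1 \<subseteq> E" "A2 \<subseteq> E" and X: "open X1" "open X2" "X1 \<inter> X2 = {}"
    and XA: "X1 \<inter> img \<gamma> (A1 \<union> A2) = {}" "X2 \<inter> img \<gamma> (A1 \<union> A2) = {}"
    and S: "closed S1" "closed S2"
    and AA: "img \<gamma> A1 \<inter> img \<gamma> A2 \<subseteq> img \<gamma> (A1 \<inter> A2)"
    and cover: "p ` V \<subseteq> S1 \<union> S2" "img \<gamma> E \<subseteq> S1 \<union> S2"
  shows "E1 \<union> E2 = E" "E1 \<inter> E2 = A1 \<inter> A2" "V1 \<union> V2 = V" "V1 \<inter> V2 = \<Union> (A1 \<inter> A2)"
    "drawing V1 E1 p \<gamma>" "drawing V2 E2 p \<gamma>" "A1 \<subseteq> E1" "A2 \<subseteq> E2"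
proof -
  have SS: "S1 \<inter> S2 = img \<gamma> (A1 \<inter> A2)"
    using AA X XA img_mono[of "A1 \<inter> A2"] by (auto simp: S1_def S2_def img_Un img_def)
  show A1: "A1 \<subseteq> E1" and A2: "A2 \<subseteq> E2" using A by (auto simp: E1_def E2_def S1_def S2_def img_def)
  have "e \<in> E1 \<union> E2" if e: "e \<in> E" "e \<notin> A1 \<union> A2" for e
  proof -
    have "img \<gamma> {e} \<inter> img \<gamma> (A1 \<union> A2) = p ` (\<Union> {e} \<inter> \<Union> (A1 \<union> A2))"
      using e A by (intro img_Int) auto
    then have "path_image (\<gamma> e) \<inter> img \<gamma> (A1 \<union> A2) \<subseteq> p ` e" by (auto simp: img_def)
    moreover have "path_image (\<gamma> e) \<subseteq> S1 \<union> S2" using cover(2) e by (auto simp: img_def)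
    ultimately have sub: "path_image (\<gamma> e) - p ` e \<subseteq> X1 \<union> X2" by (auto simp: S1_def S2_def img_Un)
    then consider "path_image (\<gamma> e) - p ` e \<subseteq> X1" | "path_image (\<gamma> e) - p ` e \<subseteq> X2"
      using connectedD[OF open_edge_connected[OF e(1)] X(1,2)] X(3) by blast
    then show ?thesis
    proof cases
      case 1
      then have "path_image (\<gamma> e) \<subseteq> S1" using S e by (intro edge_in_closed) (auto simp: S1_def)
      then show ?thesis using e by (simp add: E1_def)
    next
      case 2
      then have "path_image (\<gamma> e) \<subseteq> S2" using S e by (intro edge_in_closed) (auto simp: S2_def)
      then show ?thesis using e by (simp add: E2_def)
    qed
  qed
  with A1 A2 show "E1 \<union> E2 = E" by (auto simp: E1_def E2_def)
  have "e \<in> A1 \<inter> A2" if "e \<in> E1 \<inter> E2" for e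
  proof (rule edge_subset_img)
    show "e \<in> E" "A1 \<inter> A2 \<subseteq> E" using that A by (auto simp: E1_def)
    have "path_image (\<gamma> e) \<subseteq> S1 \<inter> S2" using that by (simp add: E1_def E2_def)
    then show "path_image (\<gamma> e) \<subseteq> img \<gamma> (A1 \<inter> A2)" by (simp only: SS)
  qed
  with A1 A2 show "E1 \<inter> E2 = A1 \<inter> A2" by auto
  show "V1 \<union> V2 = V" using cover(1) by (auto simp: V1_def V2_def)
  have "V1 \<inter> V2 = {v \<in> V. p v \<in> img \<gamma> (A1 \<inter> A2)}" using SS by (auto simp: V1_def V2_def)
  then show "V1 \<inter> V2 = \<Union> (A1 \<inter> A2)" using vertex_in_img[of "A1 \<inter> A2"] A by auto
  have "v \<in> V1" if "e \<in> E1" "v \<in> e" for v e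
    using that edge_vertices[of e] edge(1)[of e] by (auto simp: V1_def E1_def)
  then show "drawing V1 E1 p \<gamma>" by (intro subdrawing) (auto simp: V1_def E1_def)
  have "v \<in> V2" if "e \<in> E2" "v \<in> e" for v e
    using that edge_vertices[of e] edge(1)[of e] by (auto simp: V2_def E2_def)
  then show "drawing V2 E2 p \<gamma>" by (intro subdrawing) (auto simp: V2_def E2_def)
qed

end

text \<open>Points near \<open>z0\<close> are sent far away, so the image of the punctured inside is
  unbounded and lies outside the new curve. If the image of the outside lay there too, almost
  nothing would be left for the new inside.\<close>

lemma inversion_outside:
  fixes g :: "real \<Rightarrow> complex"
  assumes g: "simple_path g" "pathfinish g = pathstart g" and z0: "z0 \<in> inside (path_image g)"
  defines "f \<equiv> \<lambda>z. inverse (z - z0)"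
  shows "f ` outside (path_image g) \<subseteq> inside (f ` path_image g)"
proof -
  let ?J = "path_image g"
  have J: "open (inside ?J)" "connected (inside ?J)" "connected (outside ?J)"
    "inside ?J \<inter> outside ?J = {}" "inside ?J \<union> outside ?J = - ?J"
    using Jordan_inside_outside[OF g] by - (elim conjE, assumption)+
  have z0J: "z0 \<notin> ?J" "z0 \<notin> outside ?J"
    using z0 J(4,5) by blast+
  have inj: "inj_on f (- {z0})" by (auto simp: inj_on_def f_def)
  have cont: "continuous_on S f" if "z0 \<notin> S" for S
    unfolding f_def using that by (intro continuous_intros) auto
  have g': "simple_path (f \<circ> g)" "pathfinish (f \<circ> g) = pathstart (f \<circ> g)"
    using g cont[OF z0J(1)] inj_on_subset[OF inj, of ?J] z0J(1)
    by (auto intro!: simple_path_continuous_image simp: pathstart_compose pathfinish_compose)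
  have J': "path_image (f \<circ> g) = f ` ?J" by (rule path_image_compose)
  have K: "open (inside (f ` ?J))" "open (outside (f ` ?J))" "bounded (inside (f ` ?J))" "inside (f ` ?J) \<noteq> {}"
    "inside (f ` ?J) \<inter> outside (f ` ?J) = {}" "inside (f ` ?J) \<union> outside (f ` ?J) = - f ` ?J"
    using Jordan_inside_outside[OF g', unfolded J'] by - (elim conjE, assumption)+
  define O' where "O' = f ` outside ?J"
  define I' where "I' = f ` (inside ?J - {z0})"
  have disj: "O' \<inter> f ` ?J = {}" "I' \<inter> f ` ?J = {}"
    unfolding O'_def I'_def using z0J J(4,5)
    by (subst inj_on_image_Int[OF inj, symmetric]; blast)+
  have conn: "connected O'" "connected I'"
    unfolding O'_def I'_def
    using J cont z0J connected_open_delete[of "inside ?J" z0]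
    by (intro connected_continuous_image; simp)+
  have sub: "S \<subseteq> inside (f ` ?J) \<or> S \<subseteq> outside (f ` ?J)" if "connected S" "S \<inter> f ` ?J = {}" for S
  proof -
    have "S \<subseteq> inside (f ` ?J) \<union> outside (f ` ?J)" using that(2) K(6) by auto
    moreover have "inside (f ` ?J) \<inter> S = {} \<or> outside (f ` ?J) \<inter> S = {}"
      by (rule connectedD[OF that(1) K(1,2)]) (use K(5) calculation in auto)
    ultimately show ?thesis by blast
  qed
  have "\<not> bounded I'"
  proof
    assume "bounded I'"
    then obtain M where M: "M > 0" "\<And>w. w \<in> I' \<Longrightarrow> norm w \<le> M" by (auto simp: bounded_pos)
    obtain \<epsilon> where e: "\<epsilon> > 0" "ball z0 \<epsilon> \<subseteq> inside ?J"
      using J(1) z0 open_contains_ball by metis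
    define d where "d = min (\<epsilon> / 2) (1 / (2 * M))"
    have d: "0 < d" "d < \<epsilon>" "d < 1 / M" using e(1) M(1) by (auto simp: d_def min_def field_simps)
    have "z0 + of_real d \<in> inside ?J - {z0}" using d e(2) by (auto simp: dist_norm subset_iff)
    then have "f (z0 + of_real d) \<in> I'" by (auto simp: I'_def)
    then have "norm (f (z0 + of_real d)) \<le> M" by (rule M)
    then have "inverse d \<le> M" using d(1) by (simp add: f_def norm_inverse)
    then show False using d M(1) by (simp add: field_simps)
  qed
  then have I': "I' \<subseteq> outside (f ` ?J)"
    using sub[OF conn(2) disj(2)] K(3) bounded_subset by blast
  show ?thesis
  proof (rule ccontr)
    assume "\<not> ?thesis"
    then have O': "O' \<subseteq> outside (f ` ?J)" using sub[OF conn(1) disj(1)] by (auto simp: O'_def)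
    \<comment> \<open>\<open>0\<close> is the only point that is not a value of \<open>f\<close>
      away from \<open>z0\<close>; a nonempty open set cannot consist of it alone.\<close>
    have "inside (f ` ?J) \<subseteq> {0}"
    proof
      fix w assume w: "w \<in> inside (f ` ?J)"
      show "w \<in> {0}"
      proof (rule ccontr)
        assume "w \<notin> {0}"
        then have fw: "f (z0 + inverse w) = w" "z0 + inverse w \<noteq> z0" by (auto simp: f_def)
        have "z0 + inverse w \<in> ?J \<union> outside ?J \<union> (inside ?J - {z0})" using J(5) fw(2) by blast
        then have "w \<in> f ` ?J \<union> O' \<union> I'" using fw(1) unfolding O'_def I'_def by (metis UnE UnI1 UnI2 imageI)
        then show False using w I' O' K(5) inside_no_overlap[of "f ` ?J"] by blast
      qed
    qed
    then have "finite (inside (f ` ?J))" by (rule finite_subset) simp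
    then show False using K(1,4) finite_imp_not_open by blast
  qed
qed

context drawing
begin

lemma drawing_image:
  assumes cont: "continuous_on (p ` V \<union> img \<gamma> E) f" and inj: "inj_on f (p ` V \<union> img \<gamma> E)"
  shows "drawing V E (f \<circ> p) (\<lambda>e. f \<circ> \<gamma> e)"
proof
  show "finite_simple_graph V E" by (rule graph)
  have sub: "path_image (\<gamma> e) \<subseteq> p ` V \<union> img \<gamma> E" if "e \<in> E" for e using that by (auto simp: img_def)
  have ve: "p ` V \<subseteq> p ` V \<union> img \<gamma> E" by blast
  show "plane_drawing V E (f \<circ> p) (\<lambda>e. f \<circ> \<gamma> e)"
    unfolding plane_drawing_def
  proof (intro conjI ballI impI)
    show "inj_on (f \<circ> p) V"
      using inj_p inj by (intro comp_inj_on) (auto intro: inj_on_subset)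
    fix e assume e: "e \<in> E"
    show "arc (f \<circ> \<gamma> e)"
      using arc_edge[OF e] continuous_on_subset[OF cont sub[OF e]] inj_on_subset[OF inj sub[OF e]]
      by (auto simp: arc_def path_image_def intro: path_continuous_image comp_inj_on)
    show "{pathstart (f \<circ> \<gamma> e), pathfinish (f \<circ> \<gamma> e)} = (f \<circ> p) ` e"
      unfolding image_comp[symmetric] ends[OF e, symmetric] by (simp add: pathstart_compose pathfinish_compose)
    show "path_image (f \<circ> \<gamma> e) \<inter> (f \<circ> p) ` V = (f \<circ> p) ` e"
      unfolding path_image_compose image_comp[symmetric] edge_vertices[OF e, symmetric]
      by (rule inj_on_image_Int[OF inj sub[OF e] ve, symmetric])
    fix e' assume e': "e' \<in> E" "e \<noteq> e'"
    show "path_image (f \<circ> \<gamma> e) \<inter> path_image (f \<circ> \<gamma> e') = (f \<circ> p) ` (e \<inter> e')"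
      unfolding path_image_compose image_comp[symmetric] edges_meet[OF e e', symmetric]
      by (rule inj_on_image_Int[OF inj sub[OF e] sub[OF e'(1)], symmetric])
  qed
qed

end

section \<open>Cutting a plane graph along an ear of a cycle\<close>

definition encloses :: "('a set \<Rightarrow> real \<Rightarrow> complex) \<Rightarrow> 'a list \<Rightarrow> complex set \<Rightarrow> bool" where
  "encloses \<gamma> c S \<longleftrightarrow> S \<subseteq> img \<gamma> (cedges c) \<union> inside (img \<gamma> (cedges c))"

locale drawing7 = drawing +
  assumes girth7: "distinct c \<Longrightarrow> 3 \<le> length c \<Longrightarrow> cedges c \<subseteq> E \<Longrightarrow> 7 \<le> length c"
begin

lemma drawing7_sub: "drawing V' E' p' \<gamma>' \<Longrightarrow> E' \<subseteq> E \<Longrightarrow> drawing7 V' E' p' \<gamma>'"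
  using girth7 by (auto simp: drawing7_def drawing7_axioms_def)

lemma finite_components:
  assumes "V1 \<union> V2 = V" "E1 \<union> E2 = E"
  shows "card V1 + card V2 = card V + card (V1 \<inter> V2)" "card E1 + card E2 = card E + card (E1 \<inter> E2)"
  using assms finite_V finite_E card_Un_Int[of V1 V2] card_Un_Int[of E1 E2] finite_subset by auto

text \<open>With \<open>l\<close> the number of inner vertices of the ear, the two parts share \<open>l + 2\<close> vertices and
  \<open>l + 1\<close> edges, and their cycles have total length \<open>|c| + 2l + 2\<close>; adding the two bounds
  gives exactly the bound for the whole.\<close>

lemma ear_bound:
  assumes c: "distinct c" "3 \<le> length c" "cedges c \<subseteq> E" "encloses \<gamma> c (p ` V \<union> img \<gamma> E)"
    and P: "distinct (u # is @ [v])" "u \<in> set c" "v \<in> set c" "set is \<inter> set c = {}"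
      "pedges (u # is @ [v]) \<subseteq> E" "pedges (u # is @ [v]) \<inter> cedges c = {}"
    and IH: "\<And>V' E' c'. drawing7 V' E' p \<gamma> \<Longrightarrow> card V' + card E' < card V + card E \<Longrightarrow>
      distinct c' \<Longrightarrow> 3 \<le> length c' \<Longrightarrow> cedges c' \<subseteq> E' \<Longrightarrow> encloses \<gamma> c' (p ` V' \<union> img \<gamma> E') \<Longrightarrow>
      5 * card E' + length c' + 7 \<le> 7 * card V'"
  shows "5 * card E + length c + 7 \<le> 7 * card V"
proof -
  have "u \<noteq> v" using P(1) by auto
  then obtain as bs where d: "distinct (u # as @ v # bs)" "cedges (u # as @ v # bs) = cedges c"
    "set (u # as @ v # bs) = set c" "length (u # as @ v # bs) = length c"
    using cycle_rotate[OF c(1) P(2,3)] by metis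
  define A where "A = pedges (u # as @ [v])"
  define B where "B = pedges (u # rev bs @ [v])"
  define R where "R = pedges (u # is @ [v])"
  define c1 where "c1 = u # as @ v # rev is"
  define c2 where "c2 = u # rev bs @ v # rev is"
  have cAB: "cedges c = A \<union> B" unfolding d(2)[symmetric] A_def B_def by (rule cedges_split)
  have AB: "A \<inter> B = {}" unfolding A_def B_def by (rule cedges_parts) (use d c in auto)
  have sub: "A \<subseteq> E" "B \<subseteq> E" "R \<subseteq> E" using c(3) P(5) by (auto simp: cAB R_def)
  have RAB: "R \<inter> A = {}" "R \<inter> B = {}" using P(6) by (auto simp: cAB R_def)
  have is': "set is \<inter> set as = {}" "set is \<inter> set bs = {}" "u \<notin> set is" "v \<notin> set is" "distinct is"
    using P(1,4) d(3) by auto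
  have cc: "cedges c1 = A \<union> R" "cedges c2 = B \<union> R"
    unfolding c1_def c2_def cedges_split by (simp_all add: A_def B_def R_def)
  have cd: "distinct c1" "distinct c2" using d(1) is' by (auto simp: c1_def c2_def)
  \<comment> \<open>If both lists were empty, the ear would be an edge of \<open>c\<close>.\<close>
  have "as \<noteq> [] \<or> is \<noteq> []" "bs \<noteq> [] \<or> is \<noteq> []" using RAB by (auto simp: A_def B_def R_def)
  then have c3: "3 \<le> length c1" "3 \<le> length c2" by (cases as; cases bs; cases "is"; auto simp: c1_def c2_def)+
  have cE: "cedges c1 \<subseteq> E" "cedges c2 \<subseteq> E" using cc sub by auto
  have d3: "3 \<le> length (u # as @ v # bs)" and dE: "cedges (u # as @ v # bs) \<subseteq> E" using d c by auto
  obtain gA gB where gA: "arc gA" "pathstart gA = p u" "pathfinish gA = p v" "path_image gA = img \<gamma> A"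
    and gB: "arc gB" "pathstart gB = p u" "pathfinish gB = p v" "path_image gB = img \<gamma> B"
    and gAB: "path_image gA \<inter> path_image gB = {p u, p v}" and puv: "p u \<noteq> p v"
    using cycle_arcs[OF d(1) d3 dE] unfolding A_def B_def by metis
  have "\<exists>g. arc g \<and> pathstart g = p (hd (u # is @ [v])) \<and> pathfinish g = p (last (u # is @ [v])) \<and>
      path_image g = img \<gamma> R"
    unfolding R_def by (rule path_arc) (use P in auto)
  then obtain gR where gR: "arc gR" "pathstart gR = p u" "pathfinish gR = p v" "path_image gR = img \<gamma> R"
    by auto
  have UA: "\<Union> A = set (u # as @ [v])" "\<Union> B = set (u # rev bs @ [v])" "\<Union> R = set (u # is @ [v])"
    unfolding A_def B_def R_def by (rule Union_pedges; simp)+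
  have gAR: "path_image gA \<inter> path_image gR = {p u, p v}"
  proof -
    have "\<Union> A \<inter> \<Union> R = {u, v}" unfolding UA using is' by auto
    then show ?thesis using img_Int[of A R] sub RAB gA gR by (simp add: Int_commute)
  qed
  have gBR: "path_image gB \<inter> path_image gR = {p u, p v}"
  proof -
    have "\<Union> B \<inter> \<Union> R = {u, v}" unfolding UA using is' by auto
    then show ?thesis using img_Int[of B R] sub RAB gB gR by (simp add: Int_commute)
  qed
  have J: "img \<gamma> (cedges c) = path_image gA \<union> path_image gB" by (simp add: cAB img_Un gA gB)
  have Rin: "path_image gR - {p u, p v} \<subseteq> inside (path_image gA \<union> path_image gB)"
  proof -
    have "path_image gR \<subseteq> img \<gamma> E" using sub by (auto simp: gR img_def)
    then show ?thesis using c(4) gAR gBR unfolding encloses_def J by blast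
  qed
  \<comment> \<open>The theta-curve theorem wants a point of the ear inside the cycle; the middle
    parameter avoids the ends.\<close>
  have ne: "path_image gR \<inter> inside (path_image gA \<union> path_image gB) \<noteq> {}"
  proof -
    have "gR (1/2) \<in> path_image gR" by (auto simp: path_image_def)
    moreover have "gR (1/2) \<noteq> p u" "gR (1/2) \<noteq> p v"
      using gR(1-3) inj_onD[of gR "{0..1}" "1/2" 0] inj_onD[of gR "{0..1}" "1/2" 1]
      by (auto simp: arc_def pathstart_def pathfinish_def)
    ultimately show ?thesis using Rin by blast
  qed
  define X1 where "X1 = inside (path_image gA \<union> path_image gR)"
  define X2 where "X2 = inside (path_image gB \<union> path_image gR)"
  obtain X12: "X1 \<inter> X2 = {}"
    and XX: "X1 \<union> X2 \<union> (path_image gR - {p u, p v}) = inside (path_image gA \<union> path_image gB)"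
    unfolding X1_def X2_def
    by (rule split_inside_simple_closed_curve[OF arc_imp_simple_path[OF gA(1)] gA(2,3)
          arc_imp_simple_path[OF gB(1)] gB(2,3) arc_imp_simple_path[OF gR(1)] gR(2,3) puv gAB gAR gBR ne])
  have X: "X1 = inside (img \<gamma> (cedges c1))" "X2 = inside (img \<gamma> (cedges c2))"
    by (simp_all add: X1_def X2_def cc img_Un gA gB gR)
  obtain g1 where g1: "simple_path g1" "pathfinish g1 = pathstart g1" "path_image g1 = img \<gamma> (cedges c1)"
    using cycle_loop[OF cd(1) c3(1) cE(1)] by metis
  obtain g2 where g2: "simple_path g2" "pathfinish g2 = pathstart g2" "path_image g2 = img \<gamma> (cedges c2)"
    using cycle_loop[OF cd(2) c3(2) cE(2)] by metis
  have op: "open X1" "open X2"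
    using Jordan_inside_outside[OF g1(1,2)] Jordan_inside_outside[OF g2(1,2)] by (simp_all add: X g1 g2)
  have cl: "closed (img \<gamma> (cedges c1) \<union> X1)" "closed (img \<gamma> (cedges c2) \<union> X2)"
    using closed_path_image_Un_inside[of g1] closed_path_image_Un_inside[of g2] g1 g2
    by (simp_all add: X simple_path_imp_path)
  have Xd: "X1 \<inter> (path_image gA \<union> path_image gR) = {}" "X2 \<inter> (path_image gB \<union> path_image gR) = {}"
    "X1 \<inter> (path_image gA \<union> path_image gB) = {}" "X2 \<inter> (path_image gA \<union> path_image gB) = {}"
    using XX inside_no_overlap unfolding X1_def X2_def by blast+
  have imgs: "img \<gamma> (cedges c1) = path_image gA \<union> path_image gR" "img \<gamma> (cedges c2) = path_image gB \<union> path_image gR"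
    by (simp_all add: cc img_Un gA gB gR)
  have inter: "cedges c1 \<inter> cedges c2 = R" using AB RAB by (auto simp: cc)
  define V1 where "V1 = {v \<in> V. p v \<in> img \<gamma> (cedges c1) \<union> X1}"
  define V2 where "V2 = {v \<in> V. p v \<in> img \<gamma> (cedges c2) \<union> X2}"
  define E1 where "E1 = {e \<in> E. path_image (\<gamma> e) \<subseteq> img \<gamma> (cedges c1) \<union> X1}"
  define E2 where "E2 = {e \<in> E. path_image (\<gamma> e) \<subseteq> img \<gamma> (cedges c2) \<union> X2}"
  have total: "p ` V \<union> img \<gamma> E \<subseteq> (img \<gamma> (cedges c1) \<union> X1) \<union> (img \<gamma> (cedges c2) \<union> X2)"
    using c(4) XX unfolding encloses_def J imgs by blast
  have split: "E1 \<union> E2 = E" "E1 \<inter> E2 = cedges c1 \<inter> cedges c2" "V1 \<union> V2 = V" "V1 \<inter> V2 = \<Union> (cedges c1 \<inter> cedges c2)"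
    "drawing V1 E1 p \<gamma>" "drawing V2 E2 p \<gamma>" "cedges c1 \<subseteq> E1" "cedges c2 \<subseteq> E2"
    unfolding V1_def V2_def E1_def E2_def
    by (rule region_split[OF cE op X12 _ _ cl];
      (use total Xd gAB gAR gBR in \<open>unfold img_Un imgs inter gR(4)[symmetric], blast\<close>))+
  have cV: "card (V1 \<inter> V2) = length is + 2"
    unfolding split inter UA using distinct_card[OF P(1)] by simp
  have cE': "card (E1 \<inter> E2) = length is + 1"
    unfolding split inter R_def using card_pedges[OF P(1)] by simp
  note sums = finite_components[OF split(3,1)]
  \<comment> \<open>The parts share only the ear, so each misses one arc of \<open>c\<close> and the
    induction measure drops strictly.\<close>
  have "A \<noteq> {}" "B \<noteq> {}" using UA by auto
  moreover have "A \<subseteq> E1" "B \<subseteq> E2" "E1 \<inter> E2 = R"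
    using split(2,7,8) unfolding inter by (auto simp: cc)
  ultimately have "E1 \<noteq> E" "E2 \<noteq> E" using sub(1,2) RAB by auto
  moreover have E12: "E1 \<subseteq> E" "E2 \<subseteq> E" "V1 \<subseteq> V" "V2 \<subseteq> V" using split(1,3) by auto
  ultimately have "card E1 < card E" "card E2 < card E" "card V1 \<le> card V" "card V2 \<le> card V"
    using finite_E finite_V by (simp_all add: psubset_card_mono card_mono psubset_eq)
  then have less: "card V1 + card E1 < card V + card E" "card V2 + card E2 < card V + card E" by auto
  have enc: "encloses \<gamma> c1 (p ` V1 \<union> img \<gamma> E1)" "encloses \<gamma> c2 (p ` V2 \<union> img \<gamma> E2)"
    by (auto simp: encloses_def V1_def V2_def E1_def E2_def X[symmetric] img_def[of \<gamma> "Collect _"])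
  have "5 * card E1 + length c1 + 7 \<le> 7 * card V1" "5 * card E2 + length c2 + 7 \<le> 7 * card V2"
    using IH[OF drawing7_sub[OF split(5) E12(1)] less(1) cd(1) c3(1) split(7) enc(1)]
      IH[OF drawing7_sub[OF split(6) E12(2)] less(2) cd(2) c3(2) split(8) enc(2)] by auto
  moreover have "length c1 + length c2 = length c + 2 * length is + 2"
    unfolding d(4)[symmetric] by (simp add: c1_def c2_def)
  ultimately show ?thesis using sums cV cE' by linarith
qed

end

section \<open>The number of edges of a plane graph\<close>

context drawing7
begin

text \<open>Without an ear, either all vertices lie on \<open>c\<close> and there is no chord, or a
  component off \<open>c\<close> is attached to it at one vertex at most and can be split off there:
  the shared vertex adds 7 to the right side, the second constant 7 to the left.\<close>

lemma enclosed_bound: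
  assumes c: "distinct c" "3 \<le> length c" "cedges c \<subseteq> E" "encloses \<gamma> c (p ` V \<union> img \<gamma> E)"
    and IH: "\<And>V' E' c'. drawing7 V' E' p \<gamma> \<Longrightarrow> card V' + card E' < card V + card E \<Longrightarrow>
      distinct c' \<Longrightarrow> 3 \<le> length c' \<Longrightarrow> cedges c' \<subseteq> E' \<Longrightarrow> encloses \<gamma> c' (p ` V' \<union> img \<gamma> E') \<Longrightarrow>
      5 * card E' + length c' + 7 \<le> 7 * card V'"
    and IH2: "\<And>V' E'. drawing7 V' E' p \<gamma> \<Longrightarrow> card V' + card E' < card V + card E \<Longrightarrow> V' \<noteq> {} \<Longrightarrow>
      5 * card E' + 7 \<le> 7 * card V'"
  shows "5 * card E + length c + 7 \<le> 7 * card V"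
proof (rule ccontr)
  assume contra: "\<not> ?thesis"
  have no_ear: False if "distinct (u # is @ [v])" "u \<in> set c" "v \<in> set c" "set is \<inter> set c = {}"
      "pedges (u # is @ [v]) \<subseteq> E" "pedges (u # is @ [v]) \<inter> cedges c = {}" for u "is" v
    using ear_bound[OF c that IH] contra by blast
  have cV: "set c \<subseteq> V" using Union_cedges[of c] c(2,3) edge(1) by auto
  show False
  proof (cases "V = set c")
    case True
    have "E \<subseteq> cedges c"
    proof
      fix e assume e: "e \<in> E"
      then obtain x y where xy: "e = {x, y}" "x \<noteq> y" using edge(2) by (meson card_2_iff)
      then have "x \<in> set c" "y \<in> set c" using edge(1)[OF e] True by auto
      then show "e \<in> cedges c" using no_ear[of x "[]" y] xy e by auto
    qed
    then have "card E \<le> length c"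
      using card_mono[of "cedges c" E] card_cedges[OF c(1,2)] by (simp add: cedges_def)
    moreover have "card V = length c" using True c(1) by (simp add: distinct_card)
    \<comment> \<open>With |V| = |c| and |E| <= |c| the claim follows from 6|c| + 7 <= 7|c|; this is
      where girth 7 enters the edge count.\<close>
    ultimately show False using contra girth7[OF c(1-3)] by linarith
  next
    case False
    then obtain w where w: "w \<in> V" "w \<notin> set c" using cV by auto
    define F where "F = {e \<in> E. e \<inter> set c = {}}"
    \<comment> \<open>The component of \<open>w\<close> after the vertices of \<open>c\<close> are
      removed.\<close>
    define K where "K = {y. (w, y) \<in> {(x, y). {x, y} \<in> F}\<^sup>*}"
    have wK: "w \<in> K" by (simp add: K_def)
    have KV: "K \<subseteq> V - set c"
    proof
      fix y assume "y \<in> K"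
      then have "(w, y) \<in> {(x, y). {x, y} \<in> F}\<^sup>*" by (simp add: K_def)
      then show "y \<in> V - set c"
        by (cases rule: rtranclE) (use w edge(1) in \<open>auto simp: F_def\<close>)
    qed
    have Kstep: "y \<in> K" if "x \<in> K" "{x, y} \<in> E" "y \<notin> set c" for x y
    proof -
      have "{x, y} \<in> F" using that KV by (auto simp: F_def)
      then show ?thesis using that(1) unfolding K_def by (auto intro: rtrancl_into_rtrancl)
    qed
    \<comment> \<open>Two different attachment vertices would be joined through \<open>K\<close> by
      an ear.\<close>
    have att: "y1 = y2" if y: "y1 \<in> set c" "y2 \<in> set c" and x: "x1 \<in> K" "x2 \<in> K"
        and e: "{y1, x1} \<in> E" "{x2, y2} \<in> E" for x1 x2 y1 y2
    proof (rule ccontr)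
      assume ne: "y1 \<noteq> y2"
      have "sym ({(x, y). {x, y} \<in> F}\<^sup>*)" by (intro sym_rtrancl) (auto simp: sym_def insert_commute)
      then have "(x1, w) \<in> {(x, y). {x, y} \<in> F}\<^sup>*" using x(1) unfolding K_def by (auto dest: symD)
      then have "(x1, x2) \<in> {(x, y). {x, y} \<in> F}\<^sup>*" using x(2) unfolding K_def by (auto intro: rtrancl_trans)
      then obtain xs where xs: "xs \<noteq> []" "distinct xs" "hd xs = x1" "last xs = x2" "pedges xs \<subseteq> F"
        using rtrancl_path by metis
      have disj: "set xs \<inter> set c = {}"
      proof (cases "2 \<le> length xs")
        case True
        then show ?thesis using Union_pedges[OF True] xs(5) by (auto simp: F_def)
      next
        case False
        then have "xs = [x1]" using xs(1,3) by (cases xs; cases "tl xs") auto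
        then show ?thesis using x(1) KV by auto
      qed
      define P where "P = y1 # xs @ [y2]"
      have d: "distinct P" using xs(2) disj y ne by (auto simp: P_def)
      obtain a as where a: "xs = a # as" using xs(1) by (cases xs) auto
      obtain bs b where b: "xs = bs @ [b]" using xs(1) by (metis append_butlast_last_id)
      have "pedges (xs @ [y2]) = pedges xs \<union> {{x2, y2}}"
        using pedges_append[of bs b "[y2]"] xs(4) by (simp add: b)
      then have "pedges P = {{y1, x1}} \<union> pedges xs \<union> {{x2, y2}}"
        using xs(3) by (auto simp: P_def a)
      then have "pedges P \<subseteq> E" using e xs(5) by (auto simp: F_def)
      moreover have "pedges P \<inter> cedges c = {}"
      proof -
        have "e \<notin> cedges c" if e: "e \<in> pedges P" for e
        proof
          assume "e \<in> cedges c"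
          then have "e \<subseteq> set c" using Union_cedges[of c] c(2) by auto
          then have "e \<subseteq> {y1, y2}" using pedges_subset[OF e] disj by (auto simp: P_def)
          then have "e = {hd P, last P}"
            using card_pedges_elem[OF e d] ne card_subset_eq[of "{y1, y2}" e] by (simp add: P_def)
          then have "length P = 2" using pedges_ends[OF d] e by simp
          then show False using xs(1) by (simp add: P_def)
        qed
        then show ?thesis by auto
      qed
      ultimately show False using no_ear[of y1 xs y2] d y disj unfolding P_def by blast
    qed
    obtain u where u: "u \<in> set c" "\<And>x y. x \<in> K \<Longrightarrow> y \<in> set c \<Longrightarrow> {x, y} \<in> E \<Longrightarrow> y = u"
    proof (cases "\<exists>x\<in>K. \<exists>y\<in>set c. {x, y} \<in> E")
      case True
      then obtain x y where xy: "x \<in> K" "y \<in> set c" "{x, y} \<in> E" by blast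
      show thesis
      proof (rule that[of y])
        show "y' = y" if "x' \<in> K" "y' \<in> set c" "{x', y'} \<in> E" for x' y'
          using att[of y' y x' x] that xy by (simp add: insert_commute)
      qed (rule xy)
    next
      case False
      \<comment> \<open>If nothing is attached, any vertex of \<open>c\<close> serves as
        \<open>u\<close>; it is then isolated in the second piece.\<close>
      have "hd c \<in> set c" using c(2) by (intro hd_in_set) auto
      then show thesis using that[of "hd c"] False by blast
    qed
    define E1 where "E1 = {e \<in> E. e \<inter> K = {}}"
    define E2 where "E2 = {e \<in> E. e \<inter> K \<noteq> {}}"
    have E12: "E1 \<subseteq> E" "E2 \<subseteq> E" "E1 \<union> E2 = E" "E1 \<inter> E2 = {}" by (auto simp: E1_def E2_def)
    have uK: "u \<notin> K" using KV u(1) by auto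
    have UE2: "\<Union> E2 \<subseteq> insert u K"
    proof
      fix z assume "z \<in> \<Union> E2"
      then obtain e x where e: "e \<in> E" "x \<in> K" "x \<in> e" "z \<in> e" by (auto simp: E2_def)
      show "z \<in> insert u K"
      proof (cases "z = x")
        case False
        then have "e = {x, z}" using e edge(2)[OF e(1)] by (auto simp: card_2_iff)
        then show ?thesis using u(2)[of x z] Kstep[of x z] e by auto
      qed (use e in simp)
    qed
    have D1: "drawing7 (V - K) E1 p \<gamma>"
      by (intro drawing7_sub subdrawing) (use edge(1) in \<open>auto simp: E1_def\<close>)
    have D2: "drawing7 (insert u K) E2 p \<gamma>"
      by (intro drawing7_sub subdrawing) (use UE2 E12 KV cV u(1) in auto)
    have finK: "finite K" using KV finite_V finite_subset by blast
    have "K \<subseteq> V" using KV by auto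
    then have cards: "card (V - K) + card (insert u K) = card V + 1"
      using card_Diff_subset[OF finK, of V] card_mono[OF finite_V, of K] finK uK by simp
    have cardsE: "card E1 + card E2 = card E" using finite_components[of V V E1 E2] E12 by simp
    have "card (V - K) < card V" by (rule psubset_card_mono[OF finite_V]) (use wK w in auto)
    then have l1: "card (V - K) + card E1 < card V + card E" using cardsE by linarith
    have "set c \<subseteq> V - K" using cV KV by auto
    \<comment> \<open>The second piece repeats \<open>u\<close>, so it is smaller only because the
      cycle removes more than one vertex.\<close>
    then have "3 \<le> card (V - K)"
      using card_mono[of "V - K" "set c"] finite_V c(1,2) by (simp add: distinct_card)
    then have l2: "card (insert u K) + card E2 < card V + card E" using cards cardsE by linarith
    have "cedges c \<subseteq> E1"
      using c(3) Union_cedges[of c] c(2) KV by (auto simp: E1_def)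
    moreover have "encloses \<gamma> c (p ` (V - K) \<union> img \<gamma> E1)"
      using c(4) img_mono[OF E12(1)] unfolding encloses_def by blast
    ultimately have "5 * card E1 + length c + 7 \<le> 7 * card (V - K)"
      using IH[OF D1 l1 c(1,2)] by blast
    moreover have "5 * card E2 + 7 \<le> 7 * card (insert u K)" using IH2[OF D2 l2] by simp
    ultimately show False using contra cards cardsE by linarith
  qed
qed

text \<open>The inversion centred at a point inside \<open>c\<close> moves the part outside \<open>c\<close> to the inside.\<close>

lemma cycle_bound:
  assumes c: "distinct c" "3 \<le> length c" "cedges c \<subseteq> E"
    and I: "\<And>(V' :: 'a set) E' p' \<gamma>' c'. drawing7 V' E' p' \<gamma>' \<Longrightarrow> card V' + card E' \<le> card V + card E \<Longrightarrow>
      distinct c' \<Longrightarrow> 3 \<le> length c' \<Longrightarrow> cedges c' \<subseteq> E' \<Longrightarrow> encloses \<gamma>' c' (p' ` V' \<union> img \<gamma>' E') \<Longrightarrow>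
      5 * card E' + length c' + 7 \<le> 7 * card V'"
  shows "5 * card E + 7 \<le> 7 * card V"
proof -
  let ?J = "img \<gamma> (cedges c)"
  obtain g where g: "simple_path g" "pathfinish g = pathstart g" "path_image g = ?J"
    using cycle_loop[OF c] by metis
  have J: "open (inside ?J)" "open (outside ?J)" "inside ?J \<noteq> {}"
    "inside ?J \<inter> outside ?J = {}" "inside ?J \<union> outside ?J = - ?J"
    using Jordan_inside_outside[OF g(1,2)] unfolding g(3) by - (elim conjE, assumption)+
  obtain z0 where z0: "z0 \<in> inside ?J" using J(3) by blast
  define V1 where "V1 = {v \<in> V. p v \<in> ?J \<union> inside ?J}"
  define V2 where "V2 = {v \<in> V. p v \<in> ?J \<union> outside ?J}"
  define E1 where "E1 = {e \<in> E. path_image (\<gamma> e) \<subseteq> ?J \<union> inside ?J}"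
  define E2 where "E2 = {e \<in> E. path_image (\<gamma> e) \<subseteq> ?J \<union> outside ?J}"
  have cl: "closed (?J \<union> inside ?J)" "closed (?J \<union> outside ?J)"
    using J(1,2) by (simp_all add: union_with_inside union_with_outside closed_def)
  have off: "inside ?J \<inter> img \<gamma> (cedges c \<union> cedges c) = {}" "outside ?J \<inter> img \<gamma> (cedges c \<union> cedges c) = {}"
    using J(5) unfolding Un_absorb by blast+
  have meet: "?J \<inter> ?J \<subseteq> img \<gamma> (cedges c \<inter> cedges c)" by simp
  have cover: "S \<subseteq> (?J \<union> inside ?J) \<union> (?J \<union> outside ?J)" for S using J(5) by blast
  have split: "E1 \<union> E2 = E" "E1 \<inter> E2 = cedges c \<inter> cedges c" "V1 \<union> V2 = V" "V1 \<inter> V2 = \<Union> (cedges c \<inter> cedges c)"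
    "drawing V1 E1 p \<gamma>" "drawing V2 E2 p \<gamma>" "cedges c \<subseteq> E1" "cedges c \<subseteq> E2"
    \<comment> \<open>Both boundary sets are \<open>cedges c\<close>, so the two parts share exactly
      the cycle.\<close>
    unfolding V1_def V2_def E1_def E2_def
    by (rule region_split[OF c(3) c(3) J(1,2,4) off cl meet cover cover])+
  have E12: "E1 \<subseteq> E" "E2 \<subseteq> E" "V1 \<subseteq> V" "V2 \<subseteq> V" using split(1,3) by auto
  have cV: "card (V1 \<inter> V2) = length c"
    using Union_cedges[of c] c distinct_card[OF c(1)] by (simp add: split(4))
  have cE: "card (E1 \<inter> E2) = length c" using card_cedges[OF c(1,2)] by (simp add: split(2))
  have le: "card V1 + card E1 \<le> card V + card E" "card V2 + card E2 \<le> card V + card E"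
    using E12 finite_V finite_E by (simp_all add: add_mono card_mono)
  have "encloses \<gamma> c (p ` V1 \<union> img \<gamma> E1)"
    by (auto simp: encloses_def V1_def E1_def img_def[of \<gamma> "Collect _"])
  then have 1: "5 * card E1 + length c + 7 \<le> 7 * card V1"
    by (rule I[OF drawing7_sub[OF split(5) E12(1)] le(1) c(1,2) split(7)])
  define f where "f = (\<lambda>z. inverse (z - z0))"
  have reg2: "p ` V2 \<union> img \<gamma> E2 \<subseteq> ?J \<union> outside ?J"
    by (auto simp: V2_def E2_def img_def[of \<gamma> "Collect _"])
  have z0': "z0 \<notin> ?J \<union> outside ?J" using z0 J(4,5) by blast
  have imgf: "img (\<lambda>e. f \<circ> \<gamma> e) A = f ` img \<gamma> A" for A
    by (auto simp: img_def path_image_compose)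
  have "continuous_on (?J \<union> outside ?J) f" "inj_on f (?J \<union> outside ?J)"
    using z0' by (auto simp: f_def inj_on_def intro!: continuous_intros)
  then have "drawing V2 E2 (f \<circ> p) (\<lambda>e. f \<circ> \<gamma> e)"
    using reg2 by (intro drawing.drawing_image[OF split(6)]) (auto intro: continuous_on_subset inj_on_subset)
  note D2 = drawing7_sub[OF this E12(2)]
  have "f ` outside ?J \<subseteq> inside (f ` ?J)"
    using inversion_outside[OF g(1,2)] z0 unfolding g(3) f_def by blast
  then have "encloses (\<lambda>e. f \<circ> \<gamma> e) c ((f \<circ> p) ` V2 \<union> img (\<lambda>e. f \<circ> \<gamma> e) E2)"
    using reg2 unfolding encloses_def imgf image_comp[symmetric] by blast
  then have "5 * card E2 + length c + 7 \<le> 7 * card V2"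
    by (rule I[OF D2 le(2) c(1,2) split(8)])
  \<comment> \<open>The shared cycle adds 5|c| to the edges and 7|c| to the vertices, and the two
    length terms make up the difference 2|c|.\<close>
  with 1 show ?thesis using finite_components[OF split(3,1)] cV cE by linarith
qed

text \<open>An edge that closes a cycle leads to \<open>cycle_bound\<close>. A bridge splits the
  graph into two nonempty sides; it costs 5, while the second side brings an extra 7.\<close>

lemma total_bound:
  assumes "V \<noteq> {}"
    and I: "\<And>(V' :: 'a set) E' p' \<gamma>' c'. drawing7 V' E' p' \<gamma>' \<Longrightarrow> card V' + card E' \<le> card V + card E \<Longrightarrow>
      distinct c' \<Longrightarrow> 3 \<le> length c' \<Longrightarrow> cedges c' \<subseteq> E' \<Longrightarrow> encloses \<gamma>' c' (p' ` V' \<union> img \<gamma>' E') \<Longrightarrow>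
      5 * card E' + length c' + 7 \<le> 7 * card V'"
    and IH: "\<And>V' E'. drawing7 V' E' p \<gamma> \<Longrightarrow> card V' + card E' < card V + card E \<Longrightarrow> V' \<noteq> {} \<Longrightarrow>
      5 * card E' + 7 \<le> 7 * card V'"
  shows "5 * card E + 7 \<le> 7 * card V"
proof (cases "E = {}")
  case True
  have "card V \<noteq> 0" using assms(1) finite_V by simp
  then show ?thesis using True by simp
next
  case False
  then obtain a b where ab: "{a, b} \<in> E" "a \<noteq> b" using edge(2) by (metis card_2_iff equals0I)
  define F where "F = E - {{a, b}}"
  define K where "K = {y. (a, y) \<in> {(x, y). {x, y} \<in> F}\<^sup>*}"
  have aK: "a \<in> K" by (simp add: K_def)
  have abV: "a \<in> V" "b \<in> V" using edge(1)[OF ab(1)] by auto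
  show ?thesis
  proof (cases "b \<in> K")
    case True
    then obtain xs where xs: "xs \<noteq> []" "distinct xs" "hd xs = a" "last xs = b" "pedges xs \<subseteq> F"
      using rtrancl_path[of a b F] unfolding K_def by auto
    obtain y ys where y: "xs = a # y # ys"
      using xs(1,3,4) ab(2) by (cases xs; cases "tl xs") auto
    have "ys \<noteq> []" using xs(4,5) y by (auto simp: F_def)
    then have "3 \<le> length xs" using y by (cases ys) auto
    moreover have "cedges xs \<subseteq> E"
    proof -
      obtain bs where bs: "xs = bs @ [b]" using xs(1,4) by (metis append_butlast_last_id)
      have "cedges xs = pedges xs \<union> {{b, a}}"
        using pedges_append[of bs b "[a]"] xs(3) by (simp add: cedges_def bs)
      then show ?thesis using xs(5) ab(1) by (auto simp: F_def insert_commute)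
    qed
    ultimately show ?thesis using cycle_bound[OF xs(2)] I by blast
  next
    case False
    have Kstep: "x \<in> K \<longleftrightarrow> y \<in> K" if "{x, y} \<in> F" for x y
    proof -
      have "{y, x} \<in> F" using that by (simp add: insert_commute)
      then show ?thesis using that unfolding K_def by (auto intro: rtrancl_into_rtrancl)
    qed
    have KV: "K \<subseteq> V"
    proof
      fix y assume "y \<in> K"
      then have "(a, y) \<in> {(x, y). {x, y} \<in> F}\<^sup>*" by (simp add: K_def)
      then show "y \<in> V"
        by (cases rule: rtranclE) (use abV edge(1) in \<open>auto simp: F_def\<close>)
    qed
    define E1 where "E1 = {e \<in> F. e \<subseteq> K}"
    define E2 where "E2 = {e \<in> F. e \<subseteq> V - K}"
    have "e \<in> E1 \<union> E2" if e: "e \<in> F" for e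
    proof -
      have "e \<in> E" using e by (simp add: F_def)
      then obtain x y where "e = {x, y}" "x \<in> V" "y \<in> V" using edge[of e] by (auto simp: card_2_iff)
      then show ?thesis using Kstep[of x y] e by (auto simp: E1_def E2_def)
    qed
    then have "F \<subseteq> E1 \<union> E2" by blast
    then have "card F \<le> card E1 + card E2"
      using card_mono[of "E1 \<union> E2" F] card_Un_le[of E1 E2] finite_E by (simp add: E1_def E2_def F_def)
    moreover have "card E = card F + 1" using ab(1) finite_E card_Suc_Diff1[of E "{a, b}"] by (simp add: F_def)
    ultimately have cE: "card E \<le> card E1 + card E2 + 1" by simp
    have finK: "finite K" using KV finite_V finite_subset by blast
    have cV: "card K + card (V - K) = card V"
      using card_Diff_subset[OF finK KV] card_mono[OF finite_V KV] by simp
    have E12: "E1 \<subseteq> E" "E2 \<subseteq> E" by (auto simp: E1_def E2_def F_def)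
    have "drawing7 K E1 p \<gamma>" "drawing7 (V - K) E2 p \<gamma>"
      by (intro drawing7_sub subdrawing E12 KV; auto simp: E1_def E2_def)+
    moreover have "K \<noteq> {}" "V - K \<noteq> {}" using aK abV False by auto
    moreover have "card E1 \<le> card E" "card E2 \<le> card E" using E12 finite_E by (simp_all add: card_mono)
    moreover have "card K \<noteq> 0" "card (V - K) \<noteq> 0" using finK finite_V calculation(3,4) by simp_all
    ultimately have "5 * card E1 + 7 \<le> 7 * card K" "5 * card E2 + 7 \<le> 7 * card (V - K)"
      using cV by (intro IH; simp)+
    then show ?thesis using cE cV by linarith
  qed
qed

end

text \<open>Both bounds are proved by one induction on |V| + |E|. The enclosed bound at size
  \<open>n\<close> comes first, since the total bound uses it at the same size when one side of the
  cycle contains the whole graph. Drawings are quantified because the inversion changes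
  them.\<close>

lemma edge_bound:
  fixes V :: "'a set"
  assumes "drawing7 V E p \<gamma>" "V \<noteq> {}"
  shows "5 * card E + 7 \<le> 7 * card V"
proof -
  have *: "(\<forall>V E p \<gamma> c. drawing7 V E p \<gamma> \<longrightarrow> card V + card E = n \<longrightarrow> distinct (c :: 'a list) \<longrightarrow>
      3 \<le> length c \<longrightarrow> cedges c \<subseteq> E \<longrightarrow> encloses \<gamma> c (p ` V \<union> img \<gamma> E) \<longrightarrow>
      5 * card E + length c + 7 \<le> 7 * card V) \<and>
    (\<forall>(V :: 'a set) E p \<gamma>. drawing7 V E p \<gamma> \<longrightarrow> card V + card E = n \<longrightarrow> V \<noteq> {} \<longrightarrow>
      5 * card E + 7 \<le> 7 * card V)" for n
  proof (induction n rule: less_induct)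
    case (less n)
    have I: "5 * card E + length c + 7 \<le> 7 * card V"
      if "drawing7 V E p \<gamma>" "card V + card E \<le> n" "distinct c" "3 \<le> length c" "cedges c \<subseteq> E"
        "encloses \<gamma> c (p ` V \<union> img \<gamma> E)" for V E p \<gamma> and c :: "'a list"
    proof (cases "card V + card E < n")
      case True
      then show ?thesis using less.IH that by blast
    next
      case False
      then have n: "card V + card E = n" using that(2) by simp
      show ?thesis
        by (rule drawing7.enclosed_bound[OF that(1,3-6)]; unfold n; use less.IH in blast)
    qed
    have "5 * card E + 7 \<le> 7 * card V"
      if "drawing7 V E p \<gamma>" "card V + card E = n" "V \<noteq> {}" for V :: "'a set" and E p \<gamma>
      by (rule drawing7.total_bound[OF that(1,3)]; unfold that(2); use less.IH I in blast)
    with I show ?case by blast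
  qed
  from * assms show ?thesis by blast
qed

theorem theorem4p12:
  fixes V :: "'a set" and E :: "'a set set" and \<pi> :: "'a set \<Rightarrow> bit"
  assumes "finite_simple_graph V E"
    and "planar_graph V E"
    and "girth E \<ge> 7"
  shows "\<exists>x :: 'a \<Rightarrow> bit ^ 3. strict_inversion V E \<pi> x"
proof (rule sparse_strict_inversion[OF assms(1)])
  show girth7: "7 \<le> length c" if "distinct c" "3 \<le> length c" "cedges c \<subseteq> E" for c
  proof -
    have "girth E \<le> enat (length c)"
      using graph_cycleI[OF that] unfolding girth_def by (intro INF_lower) simp
    with assms(3) have "7 \<le> enat (length c)" by (rule order_trans)
    then show ?thesis by (simp add: numeral_eq_enat)
  qed
  obtain p \<gamma> where "plane_drawing V E p \<gamma>" using assms(2) by (auto simp: planar_graph_def)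
  with assms(1) girth7 interpret drawing7 V E p \<gamma> by unfold_locales
  \<comment> \<open>Sparsity of all subgraphs holds because every subgraph inherits the drawing and
    the girth condition.\<close>
  show "5 * card E' < 7 * card V'"
    if "V' \<subseteq> V" "E' \<subseteq> E" "\<Union> E' \<subseteq> V'" "V' \<noteq> {}" for V' E'
    using edge_bound[OF drawing7_sub[OF subdrawing[OF that(1-3)] that(2)] that(4)] by simp
qed

end
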